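(* Let $\mathbb M$ be a reflexive $\mathcal R$-module. Then $\mathbb M$ is a left-exact SML $\mathcal R$-module if and only if, for every $R$-module $N$, every morphism $f\colon\mathbb M^*\to\mathcal N$ factors (via the natural morphism to $\mathcal N$ induced by the inclusion $\mathrm{Im}\, f_R\subseteq N$) through the quasi-coherent module associated with $\mathrm{Im}\, f_R$.
   Context: $R$ is an associative ring with unit; "$R$-module" means left $R$-module. An $\mathcal R$-module (resp. right $\mathcal R$-module) is a covariant additive functor from the category of left (resp. right) $R$-modules to the category of abelian groups; morphisms are natural transformations, $\mathrm{Hom}_{\mathcal R}$ denotes morphisms, and $f_N$ denotes the component of $f$ at $N$. For a right $R$-module $M$, the quasi-coherent $\mathcal R$-module associated with $M$ is $\mathcal M(N)=M\otimes_R N$; for a left $R$-module $M$, it is the right $\mathcal R$-module $\mathcal M(N)=N\otimes_R M$. The dual of an $\mathcal R$-module $\mathbb M$ is the right $\mathcal R$-module $\mathbb M^*(N):=\mathrm{Hom}_{\mathcal R}(\mathbb M,\mathcal N)$ for right $R$-modules $N$ (and symmetrically for right $\mathcal R$-modules). The $\mathcal R$-modules $\mathbb M$ considered are such that each $\mathbb M^*(N)$ is a set. $\mathbb M^*(R)$ is a left $R$-module (via functoriality in left multiplications $R\to R$), and for $f\colon\mathbb M^*\to\mathcal N$ the component $f_R\colon\mathbb M^*(R)\to\mathcal N(R)=N$ is a morphism of left $R$-modules. $\mathbb M$ is reflexive if the canonical morphism $\mathbb M\to\mathbb M^{**}$, $m\mapsto\tilde m$ with $\tilde m_{N'}(w)=w_N(m)$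 for $m\in\mathbb M(N)$, $w\in\mathbb M^*(N')$, is an isomorphism. $\mathbb M$ is left-exact if it is a left-exact functor. $\mathbb M$ is an SML $\mathcal R$-module if for every $R$-module $N$ the natural morphism $\mathbb M(N)\to\mathrm{Hom}_R(\mathbb M^*(R),N)$, $m\mapsto\tilde m$, $\tilde m(w)=w_N(m)$, is injective. *)

theory Defs
  imports "HOL-Algebra.Algebra" "HOL-Library.Equipollence"
begin

section \<open>Modules over a ring that need not be commutative\<close>

text \<open>
  The record \<^typ>\<open>('a, 'b) module\<close> of the library is used with the additive group and the scalar
  multiplication only; its fields for multiplication and unit carry no information.
  The library locale \<^locale>\<open>module\<close> requires a commutative ring, hence the following variant.
\<close>

locale left_module = R?: ring R + M?: abelian_group M
  for R :: "('a, 'm) ring_scheme" (structure) and M :: "('a, 'b, 'n) module_scheme" (structure) +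
  assumes smult_closed:
      "\<lbrakk>a \<in> carrier R; x \<in> carrier M\<rbrakk> \<Longrightarrow> a \<odot>\<^bsub>M\<^esub> x \<in> carrier M"
    and smult_l_distr:
      "\<lbrakk>a \<in> carrier R; b \<in> carrier R; x \<in> carrier M\<rbrakk>
        \<Longrightarrow> (a \<oplus>\<^bsub>R\<^esub> b) \<odot>\<^bsub>M\<^esub> x = a \<odot>\<^bsub>M\<^esub> x \<oplus>\<^bsub>M\<^esub> b \<odot>\<^bsub>M\<^esub> x"
    and smult_r_distr:
      "\<lbrakk>a \<in> carrier R; x \<in> carrier M; y \<in> carrier M\<rbrakk>
        \<Longrightarrow> a \<odot>\<^bsub>M\<^esub> (x \<oplus>\<^bsub>M\<^esub> y) = a \<odot>\<^bsub>M\<^esub> x \<oplus>\<^bsub>M\<^esub> a \<odot>\<^bsub>M\<^esub> y"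
    and smult_assoc:
      "\<lbrakk>a \<in> carrier R; b \<in> carrier R; x \<in> carrier M\<rbrakk>
        \<Longrightarrow> (a \<otimes>\<^bsub>R\<^esub> b) \<odot>\<^bsub>M\<^esub> x = a \<odot>\<^bsub>M\<^esub> (b \<odot>\<^bsub>M\<^esub> x)"
    and smult_one:
      "x \<in> carrier M \<Longrightarrow> \<one>\<^bsub>R\<^esub> \<odot>\<^bsub>M\<^esub> x = x"

text \<open>
  A right \<open>R\<close>-module \<open>P\<close> is a left module over the opposite ring: \<open>r \<odot>\<^bsub>P\<^esub> p\<close> stands for \<open>p r\<close>.
\<close>

definition opp_ring :: "('a, 'm) ring_scheme \<Rightarrow> ('a, 'm) ring_scheme" where
  "opp_ring R = R\<lparr>monoid.mult := (\<lambda>x y. y \<otimes>\<^bsub>R\<^esub> x)\<rparr>"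

text \<open>
  Elements of \<open>mod_hom\<close> are extensional functions, so that equality of functions is equality of
  morphisms. On right modules (\<open>opp_ring R\<close> in place of \<open>R\<close>) these are the right linear maps.
\<close>

definition mod_hom :: "('a, 'm) ring_scheme \<Rightarrow> ('a, 'b) module \<Rightarrow> ('a, 'c) module \<Rightarrow> ('b \<Rightarrow> 'c) set" where
  "mod_hom R M N =
    {f \<in> carrier M \<rightarrow>\<^sub>E carrier N.
       (\<forall>x\<in>carrier M. \<forall>y\<in>carrier M. f (x \<oplus>\<^bsub>M\<^esub> y) = f x \<oplus>\<^bsub>N\<^esub> f y) \<and>
       (\<forall>r\<in>carrier R. \<forall>x\<in>carrier M. f (r \<odot>\<^bsub>M\<^esub> x) = r \<odot>\<^bsub>N\<^esub> f x)}"

definition regular_module :: "('a, 'm) ring_scheme \<Rightarrow> ('a, 'a) module" where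
  "regular_module R =
    \<lparr>carrier = carrier R, monoid.mult = undefined, one = undefined,
     ring.zero = \<zero>\<^bsub>R\<^esub>, ring.add = (\<oplus>\<^bsub>R\<^esub>), smult = (\<otimes>\<^bsub>R\<^esub>)\<rparr>"

text \<open>
  \<open>U\<close> plays the role of the class of sets: a module is an object of the category of \<open>R\<close>-modules iff
  its carrier belongs to \<open>U\<close>. The closure properties (subsets, images, binary products up to
  bijection) provide submodules, quotients and finite products. Examples are all subsets of an
  infinite type, the subsets of cardinality below a fixed infinite cardinal, and the small subsets
  of a type modelling the sets of set theory.
\<close>

definition universe :: "'u set set \<Rightarrow> bool" where
  "universe U \<longleftrightarrow>
    (\<forall>A\<in>U. \<forall>B. B \<subseteq> A \<longrightarrow> B \<in> U) \<and>
    (\<forall>A\<in>U. \<forall>f. f ` A \<in> U) \<and>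
    (\<forall>A\<in>U. \<forall>B\<in>U. \<exists>C\<in>U. A \<times> B \<approx> C)"

definition lmods :: "'u set set \<Rightarrow> ('a, 'm) ring_scheme \<Rightarrow> ('a, 'u) module set" where
  "lmods U R = {N. left_module R N \<and> carrier N \<in> U}"


section \<open>Tensor products\<close>

text \<open>
  In the following, \<open>P\<close> is a right and \<open>L\<close> a left \<open>R\<close>-module, so \<open>r \<odot>\<^bsub>P\<^esub> p\<close> is \<open>p r\<close>.
\<close>

definition tensor_relators ::
    "('a, 'm) ring_scheme \<Rightarrow> ('a, 'b) module \<Rightarrow> ('a, 'c) module \<Rightarrow> ('b \<times> 'c \<Rightarrow>\<^sub>0 int) set" where
  "tensor_relators R P L =
    {frag_of (p \<oplus>\<^bsub>P\<^esub> p', l) - (frag_of (p, l) + frag_of (p', l)) | p p' l.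
       p \<in> carrier P \<and> p' \<in> carrier P \<and> l \<in> carrier L} \<union>
    {frag_of (p, l \<oplus>\<^bsub>L\<^esub> l') - (frag_of (p, l) + frag_of (p, l')) | p l l'.
       p \<in> carrier P \<and> l \<in> carrier L \<and> l' \<in> carrier L} \<union>
    {frag_of (r \<odot>\<^bsub>P\<^esub> p, l) - frag_of (p, r \<odot>\<^bsub>L\<^esub> l) | r p l.
       r \<in> carrier R \<and> p \<in> carrier P \<and> l \<in> carrier L}"

definition tensor_relations ::
    "('a, 'm) ring_scheme \<Rightarrow> ('a, 'b) module \<Rightarrow> ('a, 'c) module \<Rightarrow> ('b \<times> 'c \<Rightarrow>\<^sub>0 int) set" where
  "tensor_relations R P L =
    generate (free_Abelian_group (carrier P \<times> carrier L)) (tensor_relators R P L)"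

definition tensor ::
    "('a, 'm) ring_scheme \<Rightarrow> ('a, 'b) module \<Rightarrow> ('a, 'c) module \<Rightarrow> ('b \<times> 'c \<Rightarrow>\<^sub>0 int) set monoid" where
  "tensor R P L = free_Abelian_group (carrier P \<times> carrier L) Mod tensor_relations R P L"

definition tensor_class ::
    "('a, 'm) ring_scheme \<Rightarrow> ('a, 'b) module \<Rightarrow> ('a, 'c) module
      \<Rightarrow> ('b \<times> 'c \<Rightarrow>\<^sub>0 int) \<Rightarrow> ('b \<times> 'c \<Rightarrow>\<^sub>0 int) set" where
  "tensor_class R P L c =
    tensor_relations R P L #>\<^bsub>free_Abelian_group (carrier P \<times> carrier L)\<^esub> c"

text \<open>
  The map \<open>g \<otimes> h\<close>. The union ranges over the representatives of the class \<open>z\<close>; all of them yield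
  the same class when \<open>g\<close> and \<open>h\<close> are linear.
\<close>

definition tensor_map ::
    "('a, 'm) ring_scheme \<Rightarrow> ('a, 'b) module \<Rightarrow> ('a, 'c) module \<Rightarrow> ('a, 'd) module \<Rightarrow> ('a, 'e) module
      \<Rightarrow> ('b \<Rightarrow> 'd) \<Rightarrow> ('c \<Rightarrow> 'e) \<Rightarrow> ('b \<times> 'c \<Rightarrow>\<^sub>0 int) set \<Rightarrow> ('d \<times> 'e \<Rightarrow>\<^sub>0 int) set" where
  "tensor_map R P L P' L' g h =
    (\<lambda>z\<in>carrier (tensor R P L).
       (\<Union>c\<in>z. tensor_class R P' L' (frag_extend (\<lambda>(p, l). frag_of (g p, h l)) c)))"

text \<open>
  The identification \<open>R \<otimes>\<^bsub>R\<^esub> N = N\<close>, as the inverse of the canonical bijection \<open>n \<mapsto> 1 \<otimes> n\<close>.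
\<close>

definition lunit :: "('a, 'm) ring_scheme \<Rightarrow> ('a, 'b) module \<Rightarrow> ('a \<times> 'b \<Rightarrow>\<^sub>0 int) set \<Rightarrow> 'b" where
  "lunit R N = the_inv_into (carrier N)
    (\<lambda>n. tensor_class R (regular_module (opp_ring R)) N (frag_of (\<one>\<^bsub>R\<^esub>, n)))"


section \<open>Functors on modules and natural transformations\<close>

record ('a, 'u, 'v) mod_functor =
  Ob :: "('a, 'u) module \<Rightarrow> 'v monoid"
  Ar :: "('a, 'u) module \<Rightarrow> ('a, 'u) module \<Rightarrow> ('u \<Rightarrow> 'u) \<Rightarrow> 'v \<Rightarrow> 'v"

text \<open>
  Additive covariant functors to abelian groups (written multiplicatively). Taken over
  \<open>opp_ring R\<close>, these are the functors on right \<open>R\<close>-modules.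
\<close>

definition additive_functor ::
    "'u set set \<Rightarrow> ('a, 'm) ring_scheme \<Rightarrow> ('a, 'u, 'v) mod_functor \<Rightarrow> bool" where
  "additive_functor U R F \<longleftrightarrow>
    (\<forall>N\<in>lmods U R. comm_group (Ob F N)) \<and>
    (\<forall>N\<in>lmods U R. \<forall>N'\<in>lmods U R. \<forall>f\<in>mod_hom R N N'. Ar F N N' f \<in> hom (Ob F N) (Ob F N')) \<and>
    (\<forall>N\<in>lmods U R. \<forall>x\<in>carrier (Ob F N). Ar F N N (\<lambda>n\<in>carrier N. n) x = x) \<and>
    (\<forall>N\<in>lmods U R. \<forall>N'\<in>lmods U R. \<forall>N''\<in>lmods U R.
       \<forall>f\<in>mod_hom R N N'. \<forall>g\<in>mod_hom R N' N''. \<forall>x\<in>carrier (Ob F N).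
         Ar F N N'' (compose (carrier N) g f) x = Ar F N' N'' g (Ar F N N' f x)) \<and>
    (\<forall>N\<in>lmods U R. \<forall>N'\<in>lmods U R.
       \<forall>f\<in>mod_hom R N N'. \<forall>g\<in>mod_hom R N N'. \<forall>x\<in>carrier (Ob F N).
         Ar F N N' (\<lambda>n\<in>carrier N. f n \<oplus>\<^bsub>N'\<^esub> g n) x = Ar F N N' f x \<otimes>\<^bsub>Ob F N'\<^esub> Ar F N N' g x)"

text \<open>
  Left-exactness: exact sequences \<open>0 \<rightarrow> N \<rightarrow> N' \<rightarrow> N''\<close> go to exact sequences.
\<close>

definition left_exact ::
    "'u set set \<Rightarrow> ('a, 'm) ring_scheme \<Rightarrow> ('a, 'u, 'v) mod_functor \<Rightarrow> bool" where
  "left_exact U R F \<longleftrightarrow>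
    (\<forall>N\<in>lmods U R. \<forall>N'\<in>lmods U R. \<forall>N''\<in>lmods U R. \<forall>f\<in>mod_hom R N N'. \<forall>g\<in>mod_hom R N' N''.
       inj_on f (carrier N) \<and> f ` carrier N = a_kernel N' N'' g \<longrightarrow>
       inj_on (Ar F N N' f) (carrier (Ob F N)) \<and>
       Ar F N N' f ` carrier (Ob F N) = kernel (Ob F N') (Ob F N'') (Ar F N' N'' g))"

text \<open>
  The morphisms of functors. They are extensional in both arguments, so that equality of functions
  is equality of morphisms.
\<close>

definition nat_trans ::
    "'u set set \<Rightarrow> ('a, 'm) ring_scheme \<Rightarrow> ('a, 'u, 'v) mod_functor \<Rightarrow> ('a, 'u, 'w) mod_functor
      \<Rightarrow> (('a, 'u) module \<Rightarrow> 'v \<Rightarrow> 'w) set" where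
  "nat_trans U R F G =
    {t \<in> extensional (lmods U R).
       (\<forall>N\<in>lmods U R. t N \<in> extensional (carrier (Ob F N)) \<inter> hom (Ob F N) (Ob G N)) \<and>
       (\<forall>N\<in>lmods U R. \<forall>N'\<in>lmods U R. \<forall>f\<in>mod_hom R N N'. \<forall>x\<in>carrier (Ob F N).
          t N' (Ar F N N' f x) = Ar G N N' f (t N x))}"

definition nat_group ::
    "'u set set \<Rightarrow> ('a, 'm) ring_scheme \<Rightarrow> ('a, 'u, 'v) mod_functor \<Rightarrow> ('a, 'u, 'w) mod_functor
      \<Rightarrow> (('a, 'u) module \<Rightarrow> 'v \<Rightarrow> 'w) monoid" where
  "nat_group U R F G =
    \<lparr>carrier = nat_trans U R F G,
     monoid.mult = (\<lambda>s t. \<lambda>N\<in>lmods U R. \<lambda>x\<in>carrier (Ob F N). s N x \<otimes>\<^bsub>Ob G N\<^esub> t N x),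
     one = (\<lambda>N\<in>lmods U R. \<lambda>x\<in>carrier (Ob F N). \<one>\<^bsub>Ob G N\<^esub>)\<rparr>"

definition nat_id ::
    "'u set set \<Rightarrow> ('a, 'm) ring_scheme \<Rightarrow> ('a, 'u, 'v) mod_functor \<Rightarrow> ('a, 'u) module \<Rightarrow> 'v \<Rightarrow> 'v" where
  "nat_id U R F = (\<lambda>N\<in>lmods U R. \<lambda>x\<in>carrier (Ob F N). x)"

text \<open>The composite \<open>t \<circ> s\<close>, where \<open>F\<close> is the source of \<open>s\<close>:\<close>

definition nat_comp ::
    "'u set set \<Rightarrow> ('a, 'm) ring_scheme \<Rightarrow> ('a, 'u, 'v) mod_functor
      \<Rightarrow> (('a, 'u) module \<Rightarrow> 'w \<Rightarrow> 'z) \<Rightarrow> (('a, 'u) module \<Rightarrow> 'v \<Rightarrow> 'w) \<Rightarrow> ('a, 'u) module \<Rightarrow> 'v \<Rightarrow> 'z" where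
  "nat_comp U R F t s = (\<lambda>N\<in>lmods U R. compose (carrier (Ob F N)) (t N) (s N))"

definition nat_iso ::
    "'u set set \<Rightarrow> ('a, 'm) ring_scheme \<Rightarrow> ('a, 'u, 'v) mod_functor \<Rightarrow> ('a, 'u, 'w) mod_functor
      \<Rightarrow> (('a, 'u) module \<Rightarrow> 'v \<Rightarrow> 'w) set" where
  "nat_iso U R F G =
    {t \<in> nat_trans U R F G. \<exists>s\<in>nat_trans U R G F.
       nat_comp U R F s t = nat_id U R F \<and> nat_comp U R G t s = nat_id U R G}"


section \<open>Quasi-coherent modules\<close>

text \<open>The functor \<open>L \<mapsto> P \<otimes>\<^bsub>R\<^esub> L\<close> on left modules, for a right module \<open>P\<close>:\<close>

definition qcoh ::
    "('a, 'm) ring_scheme \<Rightarrow> ('a, 'u) module \<Rightarrow> ('a, 'u, ('u \<times> 'u \<Rightarrow>\<^sub>0 int) set) mod_functor" where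
  "qcoh R P =
    \<lparr>Ob = (\<lambda>L. tensor R P L), Ar = (\<lambda>L L' h. tensor_map R P L P L' (\<lambda>p. p) h)\<rparr>"

definition qcoh_map ::
    "'u set set \<Rightarrow> ('a, 'm) ring_scheme \<Rightarrow> ('a, 'u) module \<Rightarrow> ('a, 'u) module \<Rightarrow> ('u \<Rightarrow> 'u)
      \<Rightarrow> ('a, 'u) module \<Rightarrow> ('u \<times> 'u \<Rightarrow>\<^sub>0 int) set \<Rightarrow> ('u \<times> 'u \<Rightarrow>\<^sub>0 int) set" where
  "qcoh_map U R P P' g = (\<lambda>L\<in>lmods U R. tensor_map R P L P' L g (\<lambda>l. l))"

text \<open>The functor \<open>P \<mapsto> P \<otimes>\<^bsub>R\<^esub> L\<close> on right modules, for a left module \<open>L\<close>:\<close>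

definition rqcoh ::
    "('a, 'm) ring_scheme \<Rightarrow> ('a, 'u) module \<Rightarrow> ('a, 'u, ('u \<times> 'u \<Rightarrow>\<^sub>0 int) set) mod_functor" where
  "rqcoh R L =
    \<lparr>Ob = (\<lambda>P. tensor R P L), Ar = (\<lambda>P P' g. tensor_map R P L P' L g (\<lambda>l. l))\<rparr>"

definition rqcoh_map ::
    "'u set set \<Rightarrow> ('a, 'm) ring_scheme \<Rightarrow> ('a, 'u) module \<Rightarrow> ('a, 'u) module \<Rightarrow> ('u \<Rightarrow> 'u)
      \<Rightarrow> ('a, 'u) module \<Rightarrow> ('u \<times> 'u \<Rightarrow>\<^sub>0 int) set \<Rightarrow> ('u \<times> 'u \<Rightarrow>\<^sub>0 int) set" where
  "rqcoh_map U R L L' h = (\<lambda>P\<in>lmods U (opp_ring R). tensor_map R P L P L' (\<lambda>p. p) h)"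


section \<open>Duals, reflexive functors and strict Mittag-Leffler functors\<close>

text \<open>
  The dual of a functor \<open>F\<close> on left modules is a functor on right modules, and that of a functor
  on right modules (\<open>rdual\<close>) is a functor on left modules. Their values are families of maps, whose
  type is independent of \<open>U\<close>; no condition on the size of \<open>nat_trans U R F (qcoh R P)\<close> is needed.
\<close>

definition dual ::
    "'u set set \<Rightarrow> ('a, 'm) ring_scheme \<Rightarrow> ('a, 'u, 'v) mod_functor
      \<Rightarrow> ('a, 'u, ('a, 'u) module \<Rightarrow> 'v \<Rightarrow> ('u \<times> 'u \<Rightarrow>\<^sub>0 int) set) mod_functor" where
  "dual U R F =
    \<lparr>Ob = (\<lambda>P. nat_group U R F (qcoh R P)),
     Ar = (\<lambda>P P' g. \<lambda>w\<in>nat_trans U R F (qcoh R P). nat_comp U R F (qcoh_map U R P P' g) w)\<rparr>"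

definition rdual ::
    "'u set set \<Rightarrow> ('a, 'm) ring_scheme \<Rightarrow> ('a, 'u, 'v) mod_functor
      \<Rightarrow> ('a, 'u, ('a, 'u) module \<Rightarrow> 'v \<Rightarrow> ('u \<times> 'u \<Rightarrow>\<^sub>0 int) set) mod_functor" where
  "rdual U R F =
    \<lparr>Ob = (\<lambda>L. nat_group U (opp_ring R) F (rqcoh R L)),
     Ar = (\<lambda>L L' h. \<lambda>w\<in>nat_trans U (opp_ring R) F (rqcoh R L).
             nat_comp U (opp_ring R) F (rqcoh_map U R L L' h) w)\<rparr>"

text \<open>The canonical morphism from \<open>F\<close> to its bidual:\<close>

definition bidual_map ::
    "'u set set \<Rightarrow> ('a, 'm) ring_scheme \<Rightarrow> ('a, 'u, 'v) mod_functor \<Rightarrow> ('a, 'u) module \<Rightarrow> 'v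
      \<Rightarrow> ('a, 'u) module \<Rightarrow> (('a, 'u) module \<Rightarrow> 'v \<Rightarrow> ('u \<times> 'u \<Rightarrow>\<^sub>0 int) set) \<Rightarrow> ('u \<times> 'u \<Rightarrow>\<^sub>0 int) set" where
  "bidual_map U R F =
    (\<lambda>N\<in>lmods U R. \<lambda>m\<in>carrier (Ob F N).
       \<lambda>P\<in>lmods U (opp_ring R). \<lambda>w\<in>carrier (Ob (dual U R F) P). w N m)"

definition reflexive ::
    "'u set set \<Rightarrow> ('a, 'm) ring_scheme \<Rightarrow> ('a, 'u, 'v) mod_functor \<Rightarrow> bool" where
  "reflexive U R F \<longleftrightarrow> bidual_map U R F \<in> nat_iso U R F (rdual U R (dual U R F))"

text \<open>
  The left \<open>R\<close>-module of values of the dual at the right module \<open>R\<close>; the scalar \<open>r\<close> acts through the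
  left multiplication by \<open>r\<close>, which is an endomorphism of the right module \<open>R\<close>.
\<close>

definition dual_at_ring ::
    "'u set set \<Rightarrow> ('u, 'm) ring_scheme \<Rightarrow> ('u, 'u, 'v) mod_functor
      \<Rightarrow> ('u, ('u, 'u) module \<Rightarrow> 'v \<Rightarrow> ('u \<times> 'u \<Rightarrow>\<^sub>0 int) set) module" where
  "dual_at_ring U R F =
    (let P = regular_module (opp_ring R); G = Ob (dual U R F) P in
     \<lparr>carrier = carrier G, monoid.mult = undefined, one = undefined, ring.zero = \<one>\<^bsub>G\<^esub>, ring.add = (\<otimes>\<^bsub>G\<^esub>),
      smult = (\<lambda>r. Ar (dual U R F) P P (\<lambda>x\<in>carrier R. r \<otimes>\<^bsub>R\<^esub> x))\<rparr>)"

definition sml_map ::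
    "'u set set \<Rightarrow> ('u, 'm) ring_scheme \<Rightarrow> ('u, 'u, 'v) mod_functor \<Rightarrow> ('u, 'u) module \<Rightarrow> 'v
      \<Rightarrow> (('u, 'u) module \<Rightarrow> 'v \<Rightarrow> ('u \<times> 'u \<Rightarrow>\<^sub>0 int) set) \<Rightarrow> 'u" where
  "sml_map U R F N m = (\<lambda>w\<in>carrier (dual_at_ring U R F). lunit R N (w N m))"

definition sml_functor ::
    "'u set set \<Rightarrow> ('u, 'm) ring_scheme \<Rightarrow> ('u, 'u, 'v) mod_functor \<Rightarrow> bool" where
  "sml_functor U R F \<longleftrightarrow>
    (\<forall>N\<in>lmods U R.
       sml_map U R F N \<in> carrier (Ob F N) \<rightarrow> mod_hom R (dual_at_ring U R F) N \<and>
       inj_on (sml_map U R F N) (carrier (Ob F N)))"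

text \<open>
  For a morphism \<open>f\<close> from the dual of \<open>F\<close> to \<open>rqcoh R N\<close>: the map \<open>f\<^sub>R\<close> with values in
  \<open>R \<otimes>\<^bsub>R\<^esub> N = N\<close>, and its image as a submodule of \<open>N\<close>.
\<close>

definition component_at_ring ::
    "'u set set \<Rightarrow> ('u, 'm) ring_scheme \<Rightarrow> ('u, 'u, 'v) mod_functor \<Rightarrow> ('u, 'u) module
      \<Rightarrow> (('u, 'u) module \<Rightarrow> (('u, 'u) module \<Rightarrow> 'v \<Rightarrow> ('u \<times> 'u \<Rightarrow>\<^sub>0 int) set) \<Rightarrow> ('u \<times> 'u \<Rightarrow>\<^sub>0 int) set)
      \<Rightarrow> (('u, 'u) module \<Rightarrow> 'v \<Rightarrow> ('u \<times> 'u \<Rightarrow>\<^sub>0 int) set) \<Rightarrow> 'u" where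
  "component_at_ring U R F N f =
    (\<lambda>w\<in>carrier (dual_at_ring U R F). lunit R N (f (regular_module (opp_ring R)) w))"

definition image_module ::
    "'u set set \<Rightarrow> ('u, 'm) ring_scheme \<Rightarrow> ('u, 'u, 'v) mod_functor \<Rightarrow> ('u, 'u) module
      \<Rightarrow> (('u, 'u) module \<Rightarrow> (('u, 'u) module \<Rightarrow> 'v \<Rightarrow> ('u \<times> 'u \<Rightarrow>\<^sub>0 int) set) \<Rightarrow> ('u \<times> 'u \<Rightarrow>\<^sub>0 int) set)
      \<Rightarrow> ('u, 'u) module" where
  "image_module U R F N f =
    N\<lparr>carrier := component_at_ring U R F N f ` carrier (dual_at_ring U R F)\<rparr>"

end

theory Submission
  imports Defs
begin

text \<open>
  Reflexivity identifies a morphism \<open>f\<close> from the dual of \<open>M\<close> to the quasi-coherent functor of \<open>N\<close>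
  with an element \<open>m\<close> of \<open>M(N)\<close>, and naturality of the bidual map identifies composition of morphisms
  with the action of \<open>M\<close> on linear maps. The component of \<open>f\<close> at the ring becomes the map
  \<open>w \<mapsto> w\<^sub>N(m)\<close> on the dual at the ring; call its image \<open>I\<close> the module of values of \<open>m\<close>. The
  factorization property therefore says that every \<open>m\<close> comes from \<open>M(I)\<close> along the inclusion of \<open>I\<close>
  in \<open>N\<close> (lemma \<open>lifts_to_values_iff_factorization\<close>). It remains to compare this lifting property with
  left-exactness and the strict Mittag-Leffler condition.

  If both of these hold, let \<open>q\<close> be the projection of \<open>N\<close> onto \<open>N/I\<close>. All values of \<open>M(q)(m)\<close>
  are images of elements of \<open>I\<close> under \<open>q\<close>, hence zero, so \<open>M(q)(m)\<close> is trivial because an element is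
  determined by its values, and \<open>m\<close> lifts to \<open>M(I)\<close> by exactness of
  \<open>M(I) \<rightarrow> M(N) \<rightarrow> M(N/I)\<close> (lemma \<open>lifts_to_values_if_left_exact_sml\<close>).

  Conversely, assume that lifts exist. An element whose values all vanish comes from \<open>M\<close> of the zero
  module, so it is trivial (lemma \<open>eq_one_if_lifts_to_values\<close>); this is the Mittag-Leffler condition. If
  \<open>0 \<rightarrow> N \<rightarrow> N' \<rightarrow> N''\<close> is exact, then an element of \<open>M(N)\<close> that dies in \<open>M(N')\<close> has vanishing
  values, and an element of \<open>M(N')\<close> that dies in \<open>M(N'')\<close> has its values in the image of \<open>N\<close>, so that
  its lift to its module of values can be pushed to \<open>M(N)\<close> (lemma \<open>left_exact_if_lifts_to_values\<close>).

  The properties of tensor products that enter are that \<open>g \<otimes> h\<close> is a well-defined homomorphism, that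
  \<open>g \<otimes> 1\<close> commutes with \<open>1 \<otimes> h\<close>, and that \<open>R \<otimes> N\<close> is naturally isomorphic to \<open>N\<close>. They make
  the dual at the ring closed under its module operations and its evaluations linear and natural.
\<close>

section \<open>Linear maps and the opposite ring\<close>

text \<open>In contrast to \<^const>\<open>mod_hom\<close>, maps need not be extensional here: the identity factors in
  \<^const>\<open>qcoh\<close> and \<^const>\<open>rqcoh\<close> are total functions.\<close>

definition linear_map ::
    "('a, 'm) ring_scheme \<Rightarrow> ('a, 'b) module \<Rightarrow> ('a, 'c) module \<Rightarrow> ('b \<Rightarrow> 'c) \<Rightarrow> bool" where
  "linear_map R M N f \<longleftrightarrow>
    f \<in> carrier M \<rightarrow> carrier N \<and>
    (\<forall>x\<in>carrier M. \<forall>y\<in>carrier M. f (x \<oplus>\<^bsub>M\<^esub> y) = f x \<oplus>\<^bsub>N\<^esub> f y) \<and>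
    (\<forall>r\<in>carrier R. \<forall>x\<in>carrier M. f (r \<odot>\<^bsub>M\<^esub> x) = r \<odot>\<^bsub>N\<^esub> f x)"

lemma mod_hom_iff: "f \<in> mod_hom R M N \<longleftrightarrow> linear_map R M N f \<and> f \<in> extensional (carrier M)"
  by (auto simp: mod_hom_def linear_map_def PiE_def)

lemma mod_hom_linear: "f \<in> mod_hom R M N \<Longrightarrow> linear_map R M N f"
  by (simp add: mod_hom_iff)

lemma linear_map_closed: "linear_map R M N f \<Longrightarrow> x \<in> carrier M \<Longrightarrow> f x \<in> carrier N"
  by (auto simp: linear_map_def)

lemma linear_map_add:
  "linear_map R M N f \<Longrightarrow> x \<in> carrier M \<Longrightarrow> y \<in> carrier M \<Longrightarrow> f (x \<oplus>\<^bsub>M\<^esub> y) = f x \<oplus>\<^bsub>N\<^esub> f y"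
  by (auto simp: linear_map_def)

lemma linear_map_smult:
  "linear_map R M N f \<Longrightarrow> r \<in> carrier R \<Longrightarrow> x \<in> carrier M \<Longrightarrow> f (r \<odot>\<^bsub>M\<^esub> x) = r \<odot>\<^bsub>N\<^esub> f x"
  by (auto simp: linear_map_def)

lemma linear_map_id: "linear_map R M M (\<lambda>x. x)"
  by (auto simp: linear_map_def)

lemma opp_ring_sel [simp]:
  "carrier (opp_ring R) = carrier R" "\<one>\<^bsub>opp_ring R\<^esub> = \<one>\<^bsub>R\<^esub>" "\<zero>\<^bsub>opp_ring R\<^esub> = \<zero>\<^bsub>R\<^esub>"
  "x \<oplus>\<^bsub>opp_ring R\<^esub> y = x \<oplus>\<^bsub>R\<^esub> y" "x \<otimes>\<^bsub>opp_ring R\<^esub> y = y \<otimes>\<^bsub>R\<^esub> x"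
  by (simp_all add: opp_ring_def)

lemma ring_opp_ring:
  assumes "ring R"
  shows "ring (opp_ring R)"
proof -
  interpret ring R by fact
  show ?thesis
    by (rule ringI; (rule abelian_groupI monoidI)?)
      (auto simp: a_ac m_assoc l_distr r_distr l_neg intro!: bexI[OF _ a_inv_closed])
qed

lemma regular_module_sel [simp]:
  "carrier (regular_module R) = carrier R" "\<zero>\<^bsub>regular_module R\<^esub> = \<zero>\<^bsub>R\<^esub>"
  "x \<oplus>\<^bsub>regular_module R\<^esub> y = x \<oplus>\<^bsub>R\<^esub> y" "r \<odot>\<^bsub>regular_module R\<^esub> x = r \<otimes>\<^bsub>R\<^esub> x"
  by (simp_all add: regular_module_def)

lemma left_module_regular_module:
  assumes "ring R"
  shows "left_module R (regular_module R)"
proof -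
  interpret ring R by fact
  have "abelian_group (regular_module R)"
    by (rule abelian_groupI) (auto simp: a_ac l_neg intro!: bexI[OF _ a_inv_closed])
  then show ?thesis
    by (auto intro!: left_module.intro left_module_axioms.intro assms simp: m_assoc l_distr r_distr)
qed

section \<open>Tensor products\<close>

definition pure_tensor ::
    "('a, 'm) ring_scheme \<Rightarrow> ('a, 'b) module \<Rightarrow> ('a, 'c) module \<Rightarrow> 'b \<Rightarrow> 'c \<Rightarrow> ('b \<times> 'c \<Rightarrow>\<^sub>0 int) set" where
  "pure_tensor R P L p l = tensor_class R P L (frag_of (p, l))"

lemma tensor_relators_intros:
  "\<lbrakk>p \<in> carrier P; p' \<in> carrier P; l \<in> carrier L\<rbrakk>
    \<Longrightarrow> frag_of (p \<oplus>\<^bsub>P\<^esub> p', l) - (frag_of (p, l) + frag_of (p', l)) \<in> tensor_relators R P L"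
  "\<lbrakk>p \<in> carrier P; l \<in> carrier L; l' \<in> carrier L\<rbrakk>
    \<Longrightarrow> frag_of (p, l \<oplus>\<^bsub>L\<^esub> l') - (frag_of (p, l) + frag_of (p, l')) \<in> tensor_relators R P L"
  "\<lbrakk>r \<in> carrier R; p \<in> carrier P; l \<in> carrier L\<rbrakk>
    \<Longrightarrow> frag_of (r \<odot>\<^bsub>P\<^esub> p, l) - frag_of (p, r \<odot>\<^bsub>L\<^esub> l) \<in> tensor_relators R P L"
  unfolding tensor_relators_def by blast+

locale tensor_pair = P: left_module "opp_ring R" P + L: left_module R L
  for R :: "('a, 'm) ring_scheme" and P :: "('a, 'b) module" and L :: "('a, 'c) module"
begin

abbreviation "F \<equiv> free_Abelian_group (carrier P \<times> carrier L)"

sublocale F: comm_group F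
  by (rule abelian_free_Abelian_group)

lemma free_add_closed: "a \<in> carrier F \<Longrightarrow> b \<in> carrier F \<Longrightarrow> a + b \<in> carrier F"
  using F.m_closed[of a b] by simp

lemma free_diff_closed: "a \<in> carrier F \<Longrightarrow> b \<in> carrier F \<Longrightarrow> a - b \<in> carrier F"
  using F.m_closed[of a "- b"] by simp

lemma tensor_relators_subset: "tensor_relators R P L \<subseteq> carrier F"
  unfolding tensor_relators_def
  by (rule subsetI, elim UnE CollectE exE conjE)
    (simp_all add: free_add_closed free_diff_closed P.smult_closed L.smult_closed
      del: carrier_free_Abelian_group_iff)

sublocale rel: normal "tensor_relations R P L" F
  unfolding tensor_relations_def
  by (intro F.subgroup_imp_normal F.generate_is_subgroup tensor_relators_subset)

lemma comm_group_tensor: "comm_group (tensor R P L)"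
  unfolding tensor_def by (rule F.abelian_FactGroup) (rule rel.subgroup_axioms)

sublocale T: comm_group "tensor R P L"
  by (rule comm_group_tensor)

lemma tensor_class_hom: "tensor_class R P L \<in> hom F (tensor R P L)"
  using rel.r_coset_hom_Mod by (simp add: tensor_class_def[abs_def] tensor_def)

lemma tensor_cases:
  assumes "z \<in> carrier (tensor R P L)"
  obtains c where "c \<in> carrier F" "z = tensor_class R P L c"
  using assms by (auto simp: tensor_def tensor_class_def FactGroup_def RCOSETS_def)

lemma tensor_class_self: "c \<in> carrier F \<Longrightarrow> c \<in> tensor_class R P L c"
  unfolding tensor_class_def by (rule F.rcos_self[OF _ rel.subgroup_axioms])

lemma tensor_class_relation:
  assumes "c \<in> tensor_relations R P L"
  shows "tensor_class R P L c = \<one>\<^bsub>tensor R P L\<^esub>"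
  using rel.rcos_const[OF F.is_group assms] by (simp add: tensor_class_def tensor_def FactGroup_def)

lemma tensor_class_cong:
  assumes "c - d \<in> tensor_relators R P L" "d \<in> carrier F"
  shows "tensor_class R P L c = tensor_class R P L d"
proof -
  interpret h: group_hom F "tensor R P L" "tensor_class R P L"
    by (intro group_hom.intro group_hom_axioms.intro tensor_class_hom) unfold_locales
  have cd: "c - d \<in> carrier F" using assms(1) tensor_relators_subset by blast
  have "tensor_class R P L (c - d) = \<one>\<^bsub>tensor R P L\<^esub>"
    by (rule tensor_class_relation) (auto simp: tensor_relations_def intro: generate.incl assms)
  with h.hom_mult[OF cd assms(2)] show ?thesis
    using assms(2) h.hom_closed by auto
qed

lemma tensor_class_closed: "c \<in> carrier F \<Longrightarrow> tensor_class R P L c \<in> carrier (tensor R P L)"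
  using tensor_class_hom by (auto simp: hom_def)

lemma tensor_class_add:
  "c \<in> carrier F \<Longrightarrow> d \<in> carrier F \<Longrightarrow>
    tensor_class R P L (c + d) = tensor_class R P L c \<otimes>\<^bsub>tensor R P L\<^esub> tensor_class R P L d"
  using hom_mult[OF tensor_class_hom] by simp

lemma pure_tensor_closed:
  "p \<in> carrier P \<Longrightarrow> l \<in> carrier L \<Longrightarrow> pure_tensor R P L p l \<in> carrier (tensor R P L)"
  by (simp add: pure_tensor_def tensor_class_closed)

lemma pure_tensor_add_right:
  assumes "p \<in> carrier P" "l \<in> carrier L" "l' \<in> carrier L"
  shows "pure_tensor R P L p (l \<oplus>\<^bsub>L\<^esub> l') = pure_tensor R P L p l \<otimes>\<^bsub>tensor R P L\<^esub> pure_tensor R P L p l'"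
proof -
  have "pure_tensor R P L p (l \<oplus>\<^bsub>L\<^esub> l') = tensor_class R P L (frag_of (p, l) + frag_of (p, l'))"
    unfolding pure_tensor_def
    by (rule tensor_class_cong)
      (use assms F.m_closed[of "frag_of (p, l)" "frag_of (p, l')"] in \<open>auto simp: tensor_relators_def\<close>)
  then show ?thesis
    using assms by (simp add: tensor_class_add pure_tensor_def)
qed

lemma pure_tensor_balanced:
  assumes "r \<in> carrier R" "p \<in> carrier P" "l \<in> carrier L"
  shows "pure_tensor R P L (r \<odot>\<^bsub>P\<^esub> p) l = pure_tensor R P L p (r \<odot>\<^bsub>L\<^esub> l)"
  unfolding pure_tensor_def
  by (rule tensor_class_cong) (use assms L.smult_closed in \<open>auto simp: tensor_relators_def\<close>)

lemma tensor_induct [consumes 1, case_names pure one mult inv]: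
  assumes "z \<in> carrier (tensor R P L)"
    and pure: "\<And>p l. p \<in> carrier P \<Longrightarrow> l \<in> carrier L \<Longrightarrow> Q (pure_tensor R P L p l)"
    and one: "Q \<one>\<^bsub>tensor R P L\<^esub>"
    and mult: "\<And>x y. x \<in> carrier (tensor R P L) \<Longrightarrow> y \<in> carrier (tensor R P L) \<Longrightarrow> Q x \<Longrightarrow> Q y
      \<Longrightarrow> Q (x \<otimes>\<^bsub>tensor R P L\<^esub> y)"
    and inv: "\<And>x. x \<in> carrier (tensor R P L) \<Longrightarrow> Q x \<Longrightarrow> Q (inv\<^bsub>tensor R P L\<^esub> x)"
  shows "Q z"
proof -
  interpret h: group_hom F "tensor R P L" "tensor_class R P L"
    by (intro group_hom.intro group_hom_axioms.intro tensor_class_hom) unfold_locales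
  obtain c where c: "c \<in> carrier F" and z: "z = tensor_class R P L c"
    using assms(1) by (rule tensor_cases)
  from c have "Poly_Mapping.keys c \<subseteq> carrier P \<times> carrier L" by simp
  then have "c \<in> carrier F \<and> Q (tensor_class R P L c)"
  proof (induction c rule: frag_induction)
    case zero
    show ?case using one h.hom_one by simp
  next
    case (one x)
    then show ?case using pure[of "fst x" "snd x"] by (auto simp: pure_tensor_def)
  next
    case (diff a b)
    have b: "- b \<in> carrier F" "tensor_class R P L (- b) = inv\<^bsub>tensor R P L\<^esub> tensor_class R P L b"
      using diff h.hom_inv[of b] by auto
    have "tensor_class R P L (a + - b) =
        tensor_class R P L a \<otimes>\<^bsub>tensor R P L\<^esub> inv\<^bsub>tensor R P L\<^esub> tensor_class R P L b"
      using tensor_class_add[of a "- b"] diff b by simp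
    then show ?case
      using diff b F.m_closed[of a "- b"] mult inv h.hom_closed by auto
  qed
  then show ?thesis by (simp add: z)
qed

text \<open>Serves to compare maps on a tensor product without computing with representatives.\<close>

lemma tensor_hom_eqI:
  assumes "group G" "h \<in> hom (tensor R P L) G" "k \<in> hom (tensor R P L) G"
    and "\<And>p l. p \<in> carrier P \<Longrightarrow> l \<in> carrier L \<Longrightarrow> h (pure_tensor R P L p l) = k (pure_tensor R P L p l)"
    and "z \<in> carrier (tensor R P L)"
  shows "h z = k z"
proof -
  interpret h: group_hom "tensor R P L" G h
    using assms by (intro group_hom.intro group_hom_axioms.intro T.is_group) auto
  interpret k: group_hom "tensor R P L" G k
    using assms by (intro group_hom.intro group_hom_axioms.intro T.is_group) auto
  from assms(5) show ?thesis
    by (induction z rule: tensor_induct) (simp_all add: assms(4))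
qed

end

text \<open>
  A linear map on each factor sends every relator to a relator, so the induced map of free groups
  descends to the tensor products; in particular the union in the definition of \<^const>\<open>tensor_map\<close>
  is over equal sets.
\<close>

lemma tensor_map_class:
  assumes "tensor_pair R P L" "tensor_pair R P' L'"
    and g: "linear_map (opp_ring R) P P' g" and h: "linear_map R L L' h"
    and c: "c \<in> carrier (free_Abelian_group (carrier P \<times> carrier L))"
  defines "\<phi> \<equiv> frag_extend (\<lambda>(p, l). frag_of (g p, h l))"
  shows "tensor_map R P L P' L' g h (tensor_class R P L c) = tensor_class R P' L' (\<phi> c)"
    and "\<phi> c \<in> carrier (free_Abelian_group (carrier P' \<times> carrier L'))"
proof -
  interpret A: tensor_pair R P L by fact
  interpret B: tensor_pair R P' L' by fact
  note lin = g[THEN linear_map_closed] h[THEN linear_map_closed]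
    g[THEN linear_map_add] h[THEN linear_map_add] g[THEN linear_map_smult] h[THEN linear_map_smult]
  have closed: "\<phi> d \<in> carrier B.F" if d: "d \<in> carrier A.F" for d
  proof -
    have "Poly_Mapping.keys (case x of (p, l) \<Rightarrow> frag_of (g p, h l)) \<subseteq> carrier P' \<times> carrier L'"
      if "x \<in> Poly_Mapping.keys d" for x
      using d that lin by (auto simp: keys_frag_of)
    then show ?thesis
      using keys_frag_extend[of "\<lambda>(p, l). frag_of (g p, h l)" d] unfolding \<phi>_def by auto
  qed
  then show "\<phi> c \<in> carrier B.F" using c by blast
  have \<phi>_simps: "\<phi> (a + b) = \<phi> a + \<phi> b" "\<phi> (a - b) = \<phi> a - \<phi> b" "\<phi> (- a) = - \<phi> a"
    "\<phi> (frag_of (p, l)) = frag_of (g p, h l)" "\<phi> 0 = 0" for a b p l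
    by (simp_all add: \<phi>_def frag_extend_add frag_extend_diff frag_extend_minus)
  have relator: "\<phi> d \<in> tensor_relators R P' L'" if "d \<in> tensor_relators R P L" for d
    using that[unfolded tensor_relators_def]
  proof (elim UnE CollectE exE conjE)
    fix p p' l
    assume "d = frag_of (p \<oplus>\<^bsub>P\<^esub> p', l) - (frag_of (p, l) + frag_of (p', l))"
      "p \<in> carrier P" "p' \<in> carrier P" "l \<in> carrier L"
    then show "\<phi> d \<in> tensor_relators R P' L'"
      by (simp add: \<phi>_simps lin tensor_relators_intros)
  next
    fix p l l'
    assume "d = frag_of (p, l \<oplus>\<^bsub>L\<^esub> l') - (frag_of (p, l) + frag_of (p, l'))"
      "p \<in> carrier P" "l \<in> carrier L" "l' \<in> carrier L"
    then show "\<phi> d \<in> tensor_relators R P' L'"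
      by (simp add: \<phi>_simps lin tensor_relators_intros)
  next
    fix r p l
    assume "d = frag_of (r \<odot>\<^bsub>P\<^esub> p, l) - frag_of (p, r \<odot>\<^bsub>L\<^esub> l)"
      "r \<in> carrier R" "p \<in> carrier P" "l \<in> carrier L"
    then show "\<phi> d \<in> tensor_relators R P' L'"
      by (simp add: \<phi>_simps lin tensor_relators_intros)
  qed
  have relation: "\<phi> d \<in> tensor_relations R P' L'" if "d \<in> tensor_relations R P L" for d
    using that unfolding tensor_relations_def
  proof (induction d rule: generate.induct)
    case one
    then show ?case using generate.one[of B.F] by (simp add: \<phi>_simps)
  next
    case (incl h)
    then show ?case by (intro generate.incl relator)
  next
    case (inv h)
    then have "h \<in> carrier A.F" by (rule A.tensor_relators_subset[THEN subsetD])
    moreover from this have "\<phi> h \<in> carrier B.F" by (rule closed)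
    ultimately show ?case using generate.inv[OF relator[OF inv], of B.F] by (simp add: \<phi>_simps)
  next
    case (eng a b)
    then show ?case using generate.eng[of _ B.F] by (simp add: \<phi>_simps)
  qed
  have *: "tensor_class R P' L' (\<phi> d) = tensor_class R P' L' (\<phi> c)" if "d \<in> tensor_class R P L c" for d
  proof -
    from that obtain e where e: "e \<in> tensor_relations R P L" "d = e + c"
      by (auto simp: tensor_class_def r_coset_def)
    then have rel: "\<phi> e \<in> tensor_relations R P' L'" and "\<phi> d = \<phi> e + \<phi> c"
      using relation by (auto simp: \<phi>_simps)
    then show ?thesis
      using B.tensor_class_add[OF B.rel.subset[THEN subsetD, OF rel] closed[OF c]]
        B.tensor_class_relation[OF rel] B.tensor_class_closed[OF closed[OF c]] by simp
  qed
  have "c \<in> tensor_class R P L c"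
    using c by (rule A.tensor_class_self)
  with * have "(\<Union>d\<in>tensor_class R P L c. tensor_class R P' L' (\<phi> d)) = tensor_class R P' L' (\<phi> c)"
    by blast
  then show "tensor_map R P L P' L' g h (tensor_class R P L c) = tensor_class R P' L' (\<phi> c)"
    using A.tensor_class_closed[OF c] by (simp add: tensor_map_def \<phi>_def)
qed

lemma tensor_map_hom:
  assumes "tensor_pair R P L" "tensor_pair R P' L'"
    and "linear_map (opp_ring R) P P' g" and "linear_map R L L' h"
  shows "tensor_map R P L P' L' g h \<in> hom (tensor R P L) (tensor R P' L')"
proof -
  interpret A: tensor_pair R P L by fact
  interpret B: tensor_pair R P' L' by fact
  note tm = tensor_map_class[OF assms]
  show ?thesis
  proof (rule homI)
    fix x assume "x \<in> carrier (tensor R P L)"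
    then show "tensor_map R P L P' L' g h x \<in> carrier (tensor R P' L')"
      using tm B.tensor_class_closed by (metis A.tensor_cases)
  next
    fix x y assume "x \<in> carrier (tensor R P L)" "y \<in> carrier (tensor R P L)"
    then obtain c d where cd: "c \<in> carrier A.F" "d \<in> carrier A.F"
      "x = tensor_class R P L c" "y = tensor_class R P L d"
      by (metis A.tensor_cases)
    have "tensor_map R P L P' L' g h (tensor_class R P L (c + d)) =
        tensor_map R P L P' L' g h x \<otimes>\<^bsub>tensor R P' L'\<^esub> tensor_map R P L P' L' g h y"
      using A.F.m_closed[OF cd(1,2)] cd tm[of c] tm[of d] tm[of "c + d"] B.tensor_class_add
      by (simp add: frag_extend_add)
    then show "tensor_map R P L P' L' g h (x \<otimes>\<^bsub>tensor R P L\<^esub> y) =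
        tensor_map R P L P' L' g h x \<otimes>\<^bsub>tensor R P' L'\<^esub> tensor_map R P L P' L' g h y"
      using cd A.tensor_class_add by simp
  qed
qed

lemma tensor_map_pure:
  assumes "tensor_pair R P L" "tensor_pair R P' L'"
    and "linear_map (opp_ring R) P P' g" and "linear_map R L L' h"
    and "p \<in> carrier P" "l \<in> carrier L"
  shows "tensor_map R P L P' L' g h (pure_tensor R P L p l) = pure_tensor R P' L' (g p) (h l)"
  using tensor_map_class(1)[OF assms(1-4), of "frag_of (p, l)"] assms(5,6)
  by (simp add: pure_tensor_def)

text \<open>The identity \<open>(1 \<otimes> h) (g \<otimes> 1) = (g \<otimes> 1) (1 \<otimes> h)\<close>, which makes \<open>g \<otimes> 1\<close> a morphism of functors.\<close>

lemma tensor_map_interchange: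
  assumes P: "left_module (opp_ring R) P" "left_module (opp_ring R) P'"
    and L: "left_module R L" "left_module R L'"
    and g: "linear_map (opp_ring R) P P' g" and h: "linear_map R L L' h"
    and z: "z \<in> carrier (tensor R P L)"
  shows "tensor_map R P' L P' L' (\<lambda>p. p) h (tensor_map R P L P' L g (\<lambda>l. l) z) =
    tensor_map R P L' P' L' g (\<lambda>l. l) (tensor_map R P L P L' (\<lambda>p. p) h z)"
proof -
  have tp: "tensor_pair R P L" "tensor_pair R P' L" "tensor_pair R P L'" "tensor_pair R P' L'"
    using P L by (auto intro: tensor_pair.intro)
  interpret T': comm_group "tensor R P' L'" using tp(4) by (rule tensor_pair.comm_group_tensor)
  note homs = tensor_map_hom[OF tp(1,2) g linear_map_id] tensor_map_hom[OF tp(2,4) linear_map_id h]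
    tensor_map_hom[OF tp(1,3) linear_map_id h] tensor_map_hom[OF tp(3,4) g linear_map_id]
  note pures = tensor_map_pure[OF tp(1,2) g linear_map_id] tensor_map_pure[OF tp(2,4) linear_map_id h]
    tensor_map_pure[OF tp(1,3) linear_map_id h] tensor_map_pure[OF tp(3,4) g linear_map_id]
  have "(tensor_map R P' L P' L' (\<lambda>p. p) h \<circ> tensor_map R P L P' L g (\<lambda>l. l)) z =
    (tensor_map R P L' P' L' g (\<lambda>l. l) \<circ> tensor_map R P L P L' (\<lambda>p. p) h) z"
    by (rule tensor_pair.tensor_hom_eqI[OF tp(1) T'.is_group hom_compose[OF homs(1,2)] hom_compose[OF homs(3,4)] _ z])
      (simp add: pures g[THEN linear_map_closed] h[THEN linear_map_closed])
  then show ?thesis by simp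
qed

section \<open>The isomorphism between R \<otimes> N and N\<close>

lemma tensor_pair_regular:
  assumes "left_module R N"
  shows "tensor_pair R (regular_module (opp_ring R)) N"
proof -
  interpret left_module R N by fact
  show ?thesis
    by (intro tensor_pair.intro left_module_regular_module ring_opp_ring assms R.ring_axioms)
qed

text \<open>Writing \<open>r\<close> as \<open>1 r\<close>, the balancing relation moves it to the right factor.\<close>

lemma pure_tensor_regular:
  assumes "left_module R N" "r \<in> carrier R" "n \<in> carrier N"
  shows "pure_tensor R (regular_module (opp_ring R)) N r n =
    pure_tensor R (regular_module (opp_ring R)) N \<one>\<^bsub>R\<^esub> (r \<odot>\<^bsub>N\<^esub> n)"
proof -
  interpret N: left_module R N by fact
  interpret tensor_pair R "regular_module (opp_ring R)" N
    using assms(1) by (rule tensor_pair_regular)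
  show ?thesis
    using pure_tensor_balanced[of r "\<one>\<^bsub>R\<^esub>" n] assms by simp
qed

text \<open>Every element of \<open>R \<otimes> N\<close> is \<open>1 \<otimes> n\<close> because these elements form a subgroup that contains the
  pure tensors.\<close>

lemma tensor_regular_cases:
  assumes "left_module R N" "z \<in> carrier (tensor R (regular_module (opp_ring R)) N)"
  obtains n where "n \<in> carrier N" "z = pure_tensor R (regular_module (opp_ring R)) N \<one>\<^bsub>R\<^esub> n"
proof -
  interpret N: left_module R N by fact
  interpret tensor_pair R "regular_module (opp_ring R)" N
    using assms(1) by (rule tensor_pair_regular)
  let ?P = "regular_module (opp_ring R)"
  let ?u = "pure_tensor R ?P N \<one>\<^bsub>R\<^esub>"
  have hom: "?u \<in> hom (add_monoid N) (tensor R ?P N)"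
    by (rule homI) (auto intro: pure_tensor_closed simp: pure_tensor_add_right)
  interpret u: group_hom "add_monoid N" "tensor R ?P N" ?u
    by (intro group_hom.intro group_hom_axioms.intro hom N.a_group T.is_group)
  from assms(2) have "z \<in> ?u ` carrier N"
  proof (induction z rule: tensor_induct)
    case (pure p l)
    then show ?case using pure_tensor_regular[OF assms(1), of p l] N.smult_closed by auto
  next
    case one
    then show ?case using u.hom_one by (auto intro!: image_eqI[of _ _ "\<zero>\<^bsub>N\<^esub>"])
  next
    case (mult x y)
    then obtain a b where "a \<in> carrier N" "b \<in> carrier N" "x = ?u a" "y = ?u b" by blast
    then show ?case using u.hom_mult[of a b] by (intro image_eqI[of _ _ "a \<oplus>\<^bsub>N\<^esub> b"]) auto
  next
    case (inv x)
    then obtain a where "a \<in> carrier N" "x = ?u a" by blast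
    then show ?case using u.hom_inv[of a] N.add.inv_closed[of a]
      by (intro image_eqI[of _ _ "inv\<^bsub>add_monoid N\<^esub> a"]) auto
  qed
  then show thesis using that by blast
qed

text \<open>Multiplication \<open>(r, n) \<mapsto> r n\<close> extends to a homomorphism \<open>k\<close> from the free group to \<open>N\<close> that kills
  the relations. Equality of \<open>1 \<otimes> x\<close> and \<open>1 \<otimes> y\<close> makes the formal difference of \<open>(1, x)\<close> and \<open>(1, y)\<close>
  a relation, and \<open>k\<close> sends it to \<open>x - y\<close>.\<close>

lemma inj_on_pure_tensor_one:
  assumes "left_module R N"
  shows "inj_on (pure_tensor R (regular_module (opp_ring R)) N \<one>\<^bsub>R\<^esub>) (carrier N)"
proof -
  interpret N: left_module R N by fact
  interpret tensor_pair R "regular_module (opp_ring R)" N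
    using assms(1) by (rule tensor_pair_regular)
  let ?P = "regular_module (opp_ring R)"
  have "(\<lambda>(r, n). r \<odot>\<^bsub>N\<^esub> n) \<in> carrier ?P \<times> carrier N \<rightarrow> carrier (add_monoid N)"
    by (auto intro: N.smult_closed)
  then have "(\<lambda>(r, n). r \<odot>\<^bsub>N\<^esub> n) ` (carrier ?P \<times> carrier N) \<subseteq> carrier (add_monoid N)"
    by (simp add: image_subset_iff_funcset)
  then obtain k where k: "k \<in> hom F (add_monoid N)"
    and k_of: "\<And>x. x \<in> carrier ?P \<times> carrier N \<Longrightarrow> k (frag_of x) = (case x of (r, n) \<Rightarrow> r \<odot>\<^bsub>N\<^esub> n)"
    using comm_group.free_Abelian_group_universal[OF N.a_comm_group] by blast
  interpret k: group_hom F "add_monoid N" k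
    by (intro group_hom.intro group_hom_axioms.intro k N.a_group F.is_group)
  let ?F = "free_Abelian_group (carrier R \<times> carrier N)"
  have kdiff: "k (a - b) = \<zero>\<^bsub>N\<^esub>" if "a \<in> carrier ?F" "b \<in> carrier ?F" "k a = k b" for a b
    using that k.hom_mult[of a "- b"] k.hom_inv[of b] k.hom_closed[of b] N.add.r_inv[of "k b"] by auto
  have kadd: "k (a + b) = k a \<oplus>\<^bsub>N\<^esub> k b" "a + b \<in> carrier ?F"
    if "a \<in> carrier ?F" "b \<in> carrier ?F" for a b
    using that k.hom_mult[of a b] F.m_closed[of a b] by auto
  have k_relator: "k c = \<zero>\<^bsub>N\<^esub>" if "c \<in> tensor_relators R ?P N" for c
    using that unfolding tensor_relators_def
    by (elim UnE CollectE exE conjE)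
      (simp_all add: kdiff kadd k_of N.smult_l_distr N.smult_r_distr N.smult_assoc N.smult_closed
        del: carrier_free_Abelian_group_iff)
  have k_relation: "k c = \<zero>\<^bsub>N\<^esub>" if "c \<in> tensor_relations R ?P N" for c
  proof -
    have "tensor_relations R ?P N \<subseteq> kernel F (add_monoid N) k"
      unfolding tensor_relations_def
    proof (rule F.generate_subgroup_incl[OF _ k.subgroup_kernel])
      show "tensor_relators R ?P N \<subseteq> kernel F (add_monoid N) k"
        using k_relator tensor_relators_subset by (fastforce simp: kernel_def simp del: regular_module_sel carrier_free_Abelian_group_iff)
    qed
    then show ?thesis using that by (auto simp: kernel_def)
  qed
  show ?thesis
  proof (rule inj_onI)
    fix x y assume xy: "x \<in> carrier N" "y \<in> carrier N"
      and eq: "pure_tensor R ?P N \<one>\<^bsub>R\<^esub> x = pure_tensor R ?P N \<one>\<^bsub>R\<^esub> y"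
    have F: "frag_of (\<one>\<^bsub>R\<^esub>, x) \<in> carrier F" "frag_of (\<one>\<^bsub>R\<^esub>, y) \<in> carrier F" using xy by auto
    have "frag_of (\<one>\<^bsub>R\<^esub>, x) \<in> tensor_class R ?P N (frag_of (\<one>\<^bsub>R\<^esub>, y))"
      using tensor_class_self[OF F(1)] eq by (simp add: pure_tensor_def)
    then obtain e where e: "e \<in> tensor_relations R ?P N" "frag_of (\<one>\<^bsub>R\<^esub>, x) = e + frag_of (\<one>\<^bsub>R\<^esub>, y)"
      by (auto simp: tensor_class_def r_coset_def)
    have "e \<in> carrier ?F" using rel.subset[THEN subsetD, OF e(1)] by simp
    then have "k (frag_of (\<one>\<^bsub>R\<^esub>, x)) = k e \<oplus>\<^bsub>N\<^esub> k (frag_of (\<one>\<^bsub>R\<^esub>, y))"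
      unfolding e(2) using F by (intro kadd(1)) simp_all
    then show "x = y" using k_relation[OF e(1)] xy by (simp add: k_of N.smult_one)
  qed
qed

lemma lunit_pure:
  assumes "left_module R N" "n \<in> carrier N"
  shows "lunit R N (pure_tensor R (regular_module (opp_ring R)) N \<one>\<^bsub>R\<^esub> n) = n"
  using the_inv_into_f_f[OF inj_on_pure_tensor_one[OF assms(1)] assms(2)]
  by (simp add: lunit_def pure_tensor_def[abs_def])

lemma lunit_closed:
  assumes "left_module R N" "z \<in> carrier (tensor R (regular_module (opp_ring R)) N)"
  shows "lunit R N z \<in> carrier N"
  using assms by (metis tensor_regular_cases lunit_pure)

lemma lunit_mult:
  assumes N: "left_module R N"
    and z: "z \<in> carrier (tensor R (regular_module (opp_ring R)) N)"
      "z' \<in> carrier (tensor R (regular_module (opp_ring R)) N)"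
  shows "lunit R N (z \<otimes>\<^bsub>tensor R (regular_module (opp_ring R)) N\<^esub> z') = lunit R N z \<oplus>\<^bsub>N\<^esub> lunit R N z'"
proof -
  interpret N: left_module R N by fact
  interpret tensor_pair R "regular_module (opp_ring R)" N
    using N by (rule tensor_pair_regular)
  obtain n n' where n: "n \<in> carrier N" "n' \<in> carrier N"
    "z = pure_tensor R (regular_module (opp_ring R)) N \<one>\<^bsub>R\<^esub> n"
    "z' = pure_tensor R (regular_module (opp_ring R)) N \<one>\<^bsub>R\<^esub> n'"
    using tensor_regular_cases[OF N] z by metis
  have "z \<otimes>\<^bsub>tensor R (regular_module (opp_ring R)) N\<^esub> z' =
      pure_tensor R (regular_module (opp_ring R)) N \<one>\<^bsub>R\<^esub> (n \<oplus>\<^bsub>N\<^esub> n')"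
    using n by (simp add: pure_tensor_add_right)
  then show ?thesis
    using n by (simp add: lunit_pure[OF N])
qed

lemma lunit_natural:
  assumes N: "left_module R N" "left_module R N'" and h: "linear_map R N N' h"
    and z: "z \<in> carrier (tensor R (regular_module (opp_ring R)) N)"
  shows "lunit R N' (tensor_map R (regular_module (opp_ring R)) N (regular_module (opp_ring R)) N' (\<lambda>p. p) h z)
    = h (lunit R N z)"
proof -
  interpret N: left_module R N by fact
  obtain n where n: "n \<in> carrier N" "z = pure_tensor R (regular_module (opp_ring R)) N \<one>\<^bsub>R\<^esub> n"
    using tensor_regular_cases[OF N(1) z] by metis
  then show ?thesis
    using h[THEN linear_map_closed] N
    by (simp add: tensor_map_pure[OF N[THEN tensor_pair_regular] linear_map_id h] lunit_pure)
qed

lemma linear_map_left_mult: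
  assumes "ring R" "r \<in> carrier R"
  shows "linear_map (opp_ring R) (regular_module (opp_ring R)) (regular_module (opp_ring R))
    (\<lambda>x\<in>carrier R. r \<otimes>\<^bsub>R\<^esub> x)"
proof -
  interpret ring R by fact
  show ?thesis using assms(2) by (auto simp: linear_map_def r_distr m_assoc)
qed

lemma lunit_smult:
  assumes N: "left_module R N" and r: "r \<in> carrier R"
    and z: "z \<in> carrier (tensor R (regular_module (opp_ring R)) N)"
  shows "lunit R N (tensor_map R (regular_module (opp_ring R)) N (regular_module (opp_ring R)) N
      (\<lambda>x\<in>carrier R. r \<otimes>\<^bsub>R\<^esub> x) (\<lambda>l. l) z) = r \<odot>\<^bsub>N\<^esub> lunit R N z"
proof -
  interpret N: left_module R N by fact
  obtain n where n: "n \<in> carrier N" "z = pure_tensor R (regular_module (opp_ring R)) N \<one>\<^bsub>R\<^esub> n"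
    using tensor_regular_cases[OF N z] by metis
  note tp = tensor_pair_regular[OF N]
  show ?thesis
    using n r N.smult_closed N.R.ring_axioms
    by (simp add: tensor_map_pure[OF tp tp linear_map_left_mult linear_map_id]
        pure_tensor_regular[OF N r] lunit_pure[OF N])
qed

section \<open>Submodules and quotients\<close>

context left_module
begin

lemma smult_zero_left:
  assumes "x \<in> carrier M"
  shows "\<zero> \<odot>\<^bsub>M\<^esub> x = \<zero>\<^bsub>M\<^esub>"
proof -
  have "\<zero> \<odot>\<^bsub>M\<^esub> x \<oplus>\<^bsub>M\<^esub> \<zero> \<odot>\<^bsub>M\<^esub> x = \<zero> \<odot>\<^bsub>M\<^esub> x"
    using smult_l_distr[of "\<zero>" "\<zero>" x] assms by simp
  then show ?thesis
    using smult_closed[of "\<zero>" x] assms by simp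
qed

lemma smult_minus_one:
  assumes "x \<in> carrier M"
  shows "(\<ominus> \<one>) \<odot>\<^bsub>M\<^esub> x = \<ominus>\<^bsub>M\<^esub> x"
proof -
  have "(\<ominus> \<one>) \<odot>\<^bsub>M\<^esub> x \<oplus>\<^bsub>M\<^esub> x = \<zero>\<^bsub>M\<^esub>"
    using smult_l_distr[of "\<ominus> \<one>" "\<one>" x] assms by (simp add: R.l_neg smult_one smult_zero_left)
  then show ?thesis
    using smult_closed[of "\<ominus> \<one>" x] assms by (simp add: M.minus_equality)
qed

lemma submoduleI:
  assumes "I \<subseteq> carrier M" "I \<noteq> {}"
    and "\<And>x y. x \<in> I \<Longrightarrow> y \<in> I \<Longrightarrow> x \<oplus>\<^bsub>M\<^esub> y \<in> I"
    and "\<And>r x. r \<in> carrier R \<Longrightarrow> x \<in> I \<Longrightarrow> r \<odot>\<^bsub>M\<^esub> x \<in> I"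
  shows "submodule I R M"
proof (intro submodule.intro submodule_axioms.intro M.add.subgroupI)
  fix x assume x: "x \<in> I"
  then have "(\<ominus> \<one>) \<odot>\<^bsub>M\<^esub> x \<in> I" by (intro assms(4)) auto
  then show "\<ominus>\<^bsub>M\<^esub> x \<in> I"
    using smult_minus_one[of x] x assms(1) by auto
qed (use assms in \<open>auto simp: subset_iff\<close>)

end

text \<open>The module axioms are equations and solvability of \<open>y + x = 0\<close>, hence they pass to surjective
  images; the structure on a quotient is obtained in this way.\<close>

lemma left_module_surj_image:
  assumes N: "left_module R N"
    and q_surj: "q ` carrier N = carrier Q"
    and q_add: "\<And>x y. x \<in> carrier N \<Longrightarrow> y \<in> carrier N \<Longrightarrow> q x \<oplus>\<^bsub>Q\<^esub> q y = q (x \<oplus>\<^bsub>N\<^esub> y)"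
    and q_smult: "\<And>r x. r \<in> carrier R \<Longrightarrow> x \<in> carrier N \<Longrightarrow> r \<odot>\<^bsub>Q\<^esub> q x = q (r \<odot>\<^bsub>N\<^esub> x)"
    and q_zero: "\<zero>\<^bsub>Q\<^esub> = q \<zero>\<^bsub>N\<^esub>"
  shows "left_module R Q"
proof -
  interpret N: left_module R N by fact
  have cl: "q x \<in> carrier Q" if "x \<in> carrier N" for x using that q_surj by blast
  have ex: "\<exists>x\<in>carrier N. y = q x" if "y \<in> carrier Q" for y using that q_surj by blast
  have "abelian_group Q"
  proof (rule abelian_groupI)
    fix x assume "x \<in> carrier Q"
    then obtain a where "a \<in> carrier N" "x = q a" using ex by blast
    then show "\<exists>y\<in>carrier Q. y \<oplus>\<^bsub>Q\<^esub> x = \<zero>\<^bsub>Q\<^esub>"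
      by (intro bexI[of _ "q (\<ominus>\<^bsub>N\<^esub> a)"] cl) (simp_all add: q_add q_zero N.M.l_neg)
  qed (auto dest!: ex simp: q_add q_zero N.M.a_ac cl)
  then show ?thesis
    by (intro left_module.intro left_module_axioms.intro N.R.ring_axioms)
      (auto dest!: ex simp: q_add q_smult cl N.smult_closed N.smult_l_distr N.smult_r_distr
        N.smult_assoc N.smult_one)
qed

lemma left_module_submodule:
  assumes "left_module R N" "submodule I R N"
  shows "left_module R (N\<lparr>carrier := I\<rparr>)"
proof -
  interpret N: left_module R N by fact
  interpret I: submodule I R N by fact
  have sub: "x \<in> carrier N" if "x \<in> I" for x using that I.subset by auto
  have "abelian_group (N\<lparr>carrier := I\<rparr>)"
  proof (rule abelian_groupI)
    fix x assume "x \<in> carrier (N\<lparr>carrier := I\<rparr>)"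
    then show "\<exists>y\<in>carrier (N\<lparr>carrier := I\<rparr>). y \<oplus>\<^bsub>N\<lparr>carrier := I\<rparr>\<^esub> x = \<zero>\<^bsub>N\<lparr>carrier := I\<rparr>\<^esub>"
      using I.m_inv_closed[of x] sub N.M.l_neg[of x]
      by (intro bexI[of _ "\<ominus>\<^bsub>N\<^esub> x"]) (auto simp: a_inv_def)
  qed (use I.m_closed I.one_closed in \<open>auto simp: sub N.M.a_ac\<close>)
  then show ?thesis
    by (intro left_module.intro left_module_axioms.intro N.R.ring_axioms)
      (auto simp: sub I.smult_closed N.smult_l_distr N.smult_r_distr N.smult_assoc N.smult_one)
qed

lemma linear_map_zero:
  assumes "left_module R N" "left_module R N'" "linear_map R N N' f"
  shows "f \<zero>\<^bsub>N\<^esub> = \<zero>\<^bsub>N'\<^esub>"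
proof -
  interpret N: left_module R N by fact
  interpret N': left_module R N' by fact
  have "f \<zero>\<^bsub>N\<^esub> \<oplus>\<^bsub>N'\<^esub> f \<zero>\<^bsub>N\<^esub> = f \<zero>\<^bsub>N\<^esub>"
    using linear_map_add[OF assms(3), of "\<zero>\<^bsub>N\<^esub>" "\<zero>\<^bsub>N\<^esub>"] by simp
  then show ?thesis
    using linear_map_closed[OF assms(3), of "\<zero>\<^bsub>N\<^esub>"] by simp
qed

text \<open>The quotient is realised on representatives of the cosets, so that its carrier is an image of
  the carrier of the module and hence belongs to the same universe.\<close>

lemma quotient_module_exists:
  fixes N :: "('a, 'b) module"
  assumes N: "left_module R N" and I: "submodule I R N"
  obtains Q :: "('a, 'b) module" and q
  where "left_module R Q" "q ` carrier N = carrier Q" "q \<in> mod_hom R N Q" "a_kernel N Q q = I"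
proof -
  interpret N: left_module R N by fact
  interpret I: submodule I R N by fact
  have sub: "x \<in> carrier N" if "x \<in> I" for x using that I.subset by auto
  have I_add: "x \<oplus>\<^bsub>N\<^esub> y \<in> I" if "x \<in> I" "y \<in> I" for x y using that I.m_closed by simp
  have I_minus: "\<ominus>\<^bsub>N\<^esub> x \<in> I" if "x \<in> I" for x using that I.m_inv_closed by (simp add: a_inv_def)
  have I_zero: "\<zero>\<^bsub>N\<^esub> \<in> I" using I.one_closed by simp
  have minus_zero: "\<ominus>\<^bsub>N\<^esub> \<zero>\<^bsub>N\<^esub> = \<zero>\<^bsub>N\<^esub>" by (rule N.M.minus_equality) simp_all
  (* e picks a representative of the coset of its argument *)
  define e where "e n = (SOME x. x \<in> carrier N \<and> x \<ominus>\<^bsub>N\<^esub> n \<in> I)" for n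
  have e: "e n \<in> carrier N \<and> e n \<ominus>\<^bsub>N\<^esub> n \<in> I" if "n \<in> carrier N" for n
    unfolding e_def
    by (rule someI[of _ n]) (use that I_zero in \<open>simp add: a_minus_def N.M.r_neg\<close>)
  have e_eq: "e x = e y" if "x \<in> carrier N" "y \<in> carrier N" "x \<ominus>\<^bsub>N\<^esub> y \<in> I" for x y
  proof -
    have "z \<ominus>\<^bsub>N\<^esub> x \<in> I \<longleftrightarrow> z \<ominus>\<^bsub>N\<^esub> y \<in> I" if "z \<in> carrier N" for z
    proof -
      have cancel: "y \<oplus>\<^bsub>N\<^esub> (z \<oplus>\<^bsub>N\<^esub> (\<ominus>\<^bsub>N\<^esub> x \<oplus>\<^bsub>N\<^esub> \<ominus>\<^bsub>N\<^esub> y)) = z \<oplus>\<^bsub>N\<^esub> \<ominus>\<^bsub>N\<^esub> x"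
        using that \<open>x \<in> _\<close> \<open>y \<in> _\<close> N.M.r_neg2[of y "z \<oplus>\<^bsub>N\<^esub> \<ominus>\<^bsub>N\<^esub> x"] by (simp add: N.M.a_ac)
      have "z \<ominus>\<^bsub>N\<^esub> y = (z \<ominus>\<^bsub>N\<^esub> x) \<oplus>\<^bsub>N\<^esub> (x \<ominus>\<^bsub>N\<^esub> y)"
        "z \<ominus>\<^bsub>N\<^esub> x = (z \<ominus>\<^bsub>N\<^esub> y) \<oplus>\<^bsub>N\<^esub> \<ominus>\<^bsub>N\<^esub> (x \<ominus>\<^bsub>N\<^esub> y)"
        using that \<open>x \<in> _\<close> \<open>y \<in> _\<close>
        by (simp_all add: a_minus_def N.M.minus_add N.M.a_ac N.M.r_neg1 N.M.r_neg2 N.M.minus_minus cancel)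
      then show ?thesis using I_add I_minus \<open>x \<ominus>\<^bsub>N\<^esub> y \<in> I\<close> by metis
    qed
    then show ?thesis unfolding e_def by metis
  qed
  have e_add: "e (e x \<oplus>\<^bsub>N\<^esub> e y) = e (x \<oplus>\<^bsub>N\<^esub> y)" if "x \<in> carrier N" "y \<in> carrier N" for x y
  proof (rule e_eq)
    have "(e x \<oplus>\<^bsub>N\<^esub> e y) \<ominus>\<^bsub>N\<^esub> (x \<oplus>\<^bsub>N\<^esub> y) = (e x \<ominus>\<^bsub>N\<^esub> x) \<oplus>\<^bsub>N\<^esub> (e y \<ominus>\<^bsub>N\<^esub> y)"
      using that e by (simp add: a_minus_def N.M.minus_add N.M.a_ac)
    then show "(e x \<oplus>\<^bsub>N\<^esub> e y) \<ominus>\<^bsub>N\<^esub> (x \<oplus>\<^bsub>N\<^esub> y) \<in> I"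
      using I_add that e by simp
  qed (use that e in auto)
  have e_smult: "e (r \<odot>\<^bsub>N\<^esub> e x) = e (r \<odot>\<^bsub>N\<^esub> x)" if "r \<in> carrier R" "x \<in> carrier N" for r x
  proof (rule e_eq)
    have ex: "e x = (e x \<ominus>\<^bsub>N\<^esub> x) \<oplus>\<^bsub>N\<^esub> x"
      using that e[of x] by (simp add: a_minus_def N.M.a_assoc N.M.l_neg)
    have "r \<odot>\<^bsub>N\<^esub> e x = r \<odot>\<^bsub>N\<^esub> (e x \<ominus>\<^bsub>N\<^esub> x) \<oplus>\<^bsub>N\<^esub> r \<odot>\<^bsub>N\<^esub> x"
      using that e[of x] by (subst ex) (simp add: N.smult_r_distr sub)
    then have "r \<odot>\<^bsub>N\<^esub> e x \<ominus>\<^bsub>N\<^esub> r \<odot>\<^bsub>N\<^esub> x = r \<odot>\<^bsub>N\<^esub> (e x \<ominus>\<^bsub>N\<^esub> x)"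
      using that e[of x] N.smult_closed by (simp add: a_minus_def N.M.a_assoc N.M.r_neg)
    then show "r \<odot>\<^bsub>N\<^esub> e x \<ominus>\<^bsub>N\<^esub> r \<odot>\<^bsub>N\<^esub> x \<in> I"
      using I.smult_closed that e by simp
  qed (use that e N.smult_closed in auto)
  define Q :: "('a, 'b) module" where "Q = \<lparr>carrier = e ` carrier N, monoid.mult = undefined,
    one = undefined, ring.zero = e \<zero>\<^bsub>N\<^esub>, ring.add = (\<lambda>x y. e (x \<oplus>\<^bsub>N\<^esub> y)), smult = (\<lambda>r x. e (r \<odot>\<^bsub>N\<^esub> x))\<rparr>"
  have Q: "left_module R Q"
    by (rule left_module_surj_image[OF N, of e]) (simp_all add: Q_def e_add e_smult)
  have q: "restrict e (carrier N) \<in> mod_hom R N Q"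
    by (auto simp: mod_hom_def Q_def e_add e_smult N.smult_closed)
  have ker: "e x = e \<zero>\<^bsub>N\<^esub> \<longleftrightarrow> x \<in> I" if x: "x \<in> carrier N" for x
  proof
    assume "e x = e \<zero>\<^bsub>N\<^esub>"
    then have "e x \<ominus>\<^bsub>N\<^esub> x \<in> I" "e x \<in> I"
      using e[of x] e[of "\<zero>\<^bsub>N\<^esub>"] x by (auto simp: a_minus_def minus_zero)
    then have "e x \<oplus>\<^bsub>N\<^esub> \<ominus>\<^bsub>N\<^esub> (e x \<ominus>\<^bsub>N\<^esub> x) \<in> I" using I_add I_minus by blast
    moreover have "e x \<oplus>\<^bsub>N\<^esub> \<ominus>\<^bsub>N\<^esub> (e x \<ominus>\<^bsub>N\<^esub> x) = x"
      using e[of x] x by (simp add: a_minus_def N.M.minus_add N.M.r_neg2)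
    ultimately show "x \<in> I" by simp
  next
    assume "x \<in> I"
    then show "e x = e \<zero>\<^bsub>N\<^esub>" using x by (intro e_eq) (auto simp: a_minus_def minus_zero)
  qed
  show thesis
  proof (rule that[OF Q _ q])
    show "restrict e (carrier N) ` carrier N = carrier Q" by (simp add: Q_def)
    show "a_kernel N Q (restrict e (carrier N)) = I"
      using ker sub by (auto simp: a_kernel_def' Q_def)
  qed
qed

section \<open>Natural transformations into quasi-coherent modules\<close>

lemma nat_transD:
  assumes "t \<in> nat_trans U R F G" "N \<in> lmods U R"
  shows "t N \<in> hom (Ob F N) (Ob G N)" "t N \<in> extensional (carrier (Ob F N))"
  using assms by (auto simp: nat_trans_def)

lemma nat_trans_natural:
  assumes "t \<in> nat_trans U R F G" "N \<in> lmods U R" "N' \<in> lmods U R" "f \<in> mod_hom R N N'"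
    and "x \<in> carrier (Ob F N)"
  shows "t N' (Ar F N N' f x) = Ar G N N' f (t N x)"
  using assms by (auto simp: nat_trans_def)

lemma nat_iso_bij:
  assumes "t \<in> nat_iso U R F G" "N \<in> lmods U R"
  shows "bij_betw (t N) (carrier (Ob F N)) (carrier (Ob G N))"
proof -
  from assms obtain s where t: "t \<in> nat_trans U R F G" and s: "s \<in> nat_trans U R G F"
    and st: "nat_comp U R F s t = nat_id U R F" "nat_comp U R G t s = nat_id U R G"
    by (auto simp: nat_iso_def)
  note homs = t[THEN nat_transD(1), OF assms(2)] s[THEN nat_transD(1), OF assms(2)]
  have "s N (t N x) = x" if "x \<in> carrier (Ob F N)" for x
    using fun_cong[OF fun_cong[OF st(1)], of N x] that assms(2)
    by (simp add: nat_comp_def nat_id_def compose_def)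
  moreover have "t N (s N x) = x" if "x \<in> carrier (Ob G N)" for x
    using fun_cong[OF fun_cong[OF st(2)], of N x] that assms(2)
    by (simp add: nat_comp_def nat_id_def compose_def)
  ultimately show ?thesis
    using homs by (intro bij_betw_byWitness[where f' = "s N"]) (auto simp: hom_def)
qed

lemma additive_functor_comm_group:
  "additive_functor U R F \<Longrightarrow> N \<in> lmods U R \<Longrightarrow> comm_group (Ob F N)"
  by (simp add: additive_functor_def)

lemma additive_functor_hom:
  "additive_functor U R F \<Longrightarrow> N \<in> lmods U R \<Longrightarrow> N' \<in> lmods U R \<Longrightarrow> f \<in> mod_hom R N N' \<Longrightarrow>
    Ar F N N' f \<in> hom (Ob F N) (Ob F N')"
  by (simp add: additive_functor_def)

lemma additive_functor_compose:
  "additive_functor U R F \<Longrightarrow> N \<in> lmods U R \<Longrightarrow> N' \<in> lmods U R \<Longrightarrow> N'' \<in> lmods U R \<Longrightarrow>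
    f \<in> mod_hom R N N' \<Longrightarrow> g \<in> mod_hom R N' N'' \<Longrightarrow> x \<in> carrier (Ob F N) \<Longrightarrow>
    Ar F N N'' (compose (carrier N) g f) x = Ar F N' N'' g (Ar F N N' f x)"
  by (simp add: additive_functor_def)

text \<open>The zero map \<open>z\<close> satisfies \<open>z + z = z\<close>, so by additivity its action is idempotent in an abelian
  group.\<close>

lemma additive_functor_zero:
  assumes F: "additive_functor U R F" and N: "N \<in> lmods U R" "N' \<in> lmods U R"
    and x: "x \<in> carrier (Ob F N)"
  shows "Ar F N N' (\<lambda>n\<in>carrier N. \<zero>\<^bsub>N'\<^esub>) x = \<one>\<^bsub>Ob F N'\<^esub>"
proof -
  interpret N: left_module R N using N by (simp add: lmods_def)
  interpret N': left_module R N' using N by (simp add: lmods_def)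
  interpret G: comm_group "Ob F N'" using F N(2) by (rule additive_functor_comm_group)
  let ?z = "\<lambda>n\<in>carrier N. \<zero>\<^bsub>N'\<^esub>"
  have smult_zero: "r \<odot>\<^bsub>N'\<^esub> \<zero>\<^bsub>N'\<^esub> = \<zero>\<^bsub>N'\<^esub>" if r: "r \<in> carrier R" for r
  proof -
    have "r \<odot>\<^bsub>N'\<^esub> \<zero>\<^bsub>N'\<^esub> \<oplus>\<^bsub>N'\<^esub> r \<odot>\<^bsub>N'\<^esub> \<zero>\<^bsub>N'\<^esub> = r \<odot>\<^bsub>N'\<^esub> \<zero>\<^bsub>N'\<^esub>"
      using N'.smult_r_distr[of r "\<zero>\<^bsub>N'\<^esub>" "\<zero>\<^bsub>N'\<^esub>"] r by simp
    then show ?thesis using N'.smult_closed[of r "\<zero>\<^bsub>N'\<^esub>"] r by simp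
  qed
  have z: "?z \<in> mod_hom R N N'"
    by (auto simp: mod_hom_def N.smult_closed smult_zero)
  have "(\<lambda>n\<in>carrier N. ?z n \<oplus>\<^bsub>N'\<^esub> ?z n) = ?z" by (auto simp: restrict_def)
  moreover have "Ar F N N' (\<lambda>n\<in>carrier N. ?z n \<oplus>\<^bsub>N'\<^esub> ?z n) x = Ar F N N' ?z x \<otimes>\<^bsub>Ob F N'\<^esub> Ar F N N' ?z x"
    using F N x z unfolding additive_functor_def by blast
  ultimately have "Ar F N N' ?z x = Ar F N N' ?z x \<otimes>\<^bsub>Ob F N'\<^esub> Ar F N N' ?z x" by simp
  moreover have "Ar F N N' ?z x \<in> carrier (Ob F N')"
    using additive_functor_hom[OF F N z] x by (auto simp: hom_def)
  ultimately show ?thesis by simp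
qed

text \<open>Commutativity of the groups \<open>G(N)\<close> makes the pointwise product of two homomorphisms a
  homomorphism.\<close>

lemma nat_trans_mult:
  assumes F: "additive_functor U R F"
    and G: "\<And>N. N \<in> lmods U R \<Longrightarrow> comm_group (Ob G N)"
    and G_hom: "\<And>N N' f. N \<in> lmods U R \<Longrightarrow> N' \<in> lmods U R \<Longrightarrow> f \<in> mod_hom R N N' \<Longrightarrow>
      Ar G N N' f \<in> hom (Ob G N) (Ob G N')"
    and s: "s \<in> nat_trans U R F G" and t: "t \<in> nat_trans U R F G"
  shows "s \<otimes>\<^bsub>nat_group U R F G\<^esub> t \<in> nat_trans U R F G"
  unfolding nat_trans_def
proof (intro CollectI conjI ballI IntI)
  fix N assume N: "N \<in> lmods U R"
  interpret A: comm_group "Ob F N" using F N by (rule additive_functor_comm_group)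
  interpret B: comm_group "Ob G N" using N by (rule G)
  have homs: "s N \<in> hom (Ob F N) (Ob G N)" "t N \<in> hom (Ob F N) (Ob G N)"
    using s t N by (auto simp: nat_transD)
  show "(s \<otimes>\<^bsub>nat_group U R F G\<^esub> t) N \<in> hom (Ob F N) (Ob G N)"
    using N homs by (intro homI) (auto simp: nat_group_def hom_mult hom_in_carrier B.m_ac)
  show "(s \<otimes>\<^bsub>nat_group U R F G\<^esub> t) N \<in> extensional (carrier (Ob F N))"
    using N by (simp add: nat_group_def)
  fix N' f x
  assume N': "N' \<in> lmods U R" and f: "f \<in> mod_hom R N N'" and x: "x \<in> carrier (Ob F N)"
  have "Ar F N N' f x \<in> carrier (Ob F N')"
    using additive_functor_hom[OF F N N' f] x by (rule hom_in_carrier)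
  then show "(s \<otimes>\<^bsub>nat_group U R F G\<^esub> t) N' (Ar F N N' f x) = Ar G N N' f ((s \<otimes>\<^bsub>nat_group U R F G\<^esub> t) N x)"
    using N N' x homs hom_mult[OF G_hom[OF N N' f]]
      nat_trans_natural[OF s N N' f x] nat_trans_natural[OF t N N' f x]
    by (simp add: nat_group_def hom_in_carrier)
qed (simp add: nat_group_def)

lemma nat_trans_one:
  assumes F: "additive_functor U R F"
    and G: "\<And>N. N \<in> lmods U R \<Longrightarrow> comm_group (Ob G N)"
    and G_hom: "\<And>N N' f. N \<in> lmods U R \<Longrightarrow> N' \<in> lmods U R \<Longrightarrow> f \<in> mod_hom R N N' \<Longrightarrow>
      Ar G N N' f \<in> hom (Ob G N) (Ob G N')"
  shows "\<one>\<^bsub>nat_group U R F G\<^esub> \<in> nat_trans U R F G"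
  unfolding nat_trans_def
proof (intro CollectI conjI ballI IntI)
  fix N assume N: "N \<in> lmods U R"
  interpret A: comm_group "Ob F N" using F N by (rule additive_functor_comm_group)
  interpret B: comm_group "Ob G N" using N by (rule G)
  show "\<one>\<^bsub>nat_group U R F G\<^esub> N \<in> hom (Ob F N) (Ob G N)"
    using N by (intro homI) (auto simp: nat_group_def)
  show "\<one>\<^bsub>nat_group U R F G\<^esub> N \<in> extensional (carrier (Ob F N))"
    using N by (simp add: nat_group_def)
  fix N' f x
  assume N': "N' \<in> lmods U R" and f: "f \<in> mod_hom R N N'" and x: "x \<in> carrier (Ob F N)"
  interpret B': comm_group "Ob G N'" using N' by (rule G)
  have "Ar F N N' f x \<in> carrier (Ob F N')"
    using additive_functor_hom[OF F N N' f] x by (rule hom_in_carrier)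
  then show "\<one>\<^bsub>nat_group U R F G\<^esub> N' (Ar F N N' f x) = Ar G N N' f (\<one>\<^bsub>nat_group U R F G\<^esub> N x)"
    using N N' x hom_one[OF G_hom[OF N N' f] B.is_group B'.is_group] by (simp add: nat_group_def)
qed (simp add: nat_group_def)

lemma nat_trans_comp:
  assumes F: "additive_functor U R F"
    and s: "s \<in> nat_trans U R F G" and t: "t \<in> nat_trans U R G H"
  shows "nat_comp U R F t s \<in> nat_trans U R F H"
  unfolding nat_trans_def
proof (intro CollectI conjI ballI IntI)
  fix N assume N: "N \<in> lmods U R"
  have homs: "s N \<in> hom (Ob F N) (Ob G N)" "t N \<in> hom (Ob G N) (Ob H N)"
    using s t N by (auto simp: nat_transD)
  interpret A: comm_group "Ob F N" using F N by (rule additive_functor_comm_group)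
  show "nat_comp U R F t s N \<in> hom (Ob F N) (Ob H N)"
    using N homs by (intro homI) (auto simp: nat_comp_def compose_def hom_mult hom_in_carrier)
  show "nat_comp U R F t s N \<in> extensional (carrier (Ob F N))"
    using N by (simp add: nat_comp_def)
  fix N' f x
  assume N': "N' \<in> lmods U R" and f: "f \<in> mod_hom R N N'" and x: "x \<in> carrier (Ob F N)"
  have "Ar F N N' f x \<in> carrier (Ob F N')"
    using additive_functor_hom[OF F N N' f] x by (rule hom_in_carrier)
  then show "nat_comp U R F t s N' (Ar F N N' f x) = Ar H N N' f (nat_comp U R F t s N x)"
    using N N' x homs nat_trans_natural[OF s N N' f x] nat_trans_natural[OF t N N' f, of "s N x"]
    by (simp add: nat_comp_def compose_def hom_in_carrier)
qed (simp add: nat_comp_def)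

lemma qcoh_comm_group:
  "left_module (opp_ring R) P \<Longrightarrow> N \<in> lmods U R \<Longrightarrow> comm_group (Ob (qcoh R P) N)"
  by (auto simp: qcoh_def lmods_def intro!: tensor_pair.comm_group_tensor tensor_pair.intro)

lemma qcoh_hom:
  "left_module (opp_ring R) P \<Longrightarrow> N \<in> lmods U R \<Longrightarrow> N' \<in> lmods U R \<Longrightarrow> f \<in> mod_hom R N N' \<Longrightarrow>
    Ar (qcoh R P) N N' f \<in> hom (Ob (qcoh R P) N) (Ob (qcoh R P) N')"
  by (auto simp: qcoh_def lmods_def intro!: tensor_map_hom tensor_pair.intro linear_map_id mod_hom_linear)

lemma qcoh_map_nat_trans:
  assumes P: "left_module (opp_ring R) P" "left_module (opp_ring R) P'"
    and g: "linear_map (opp_ring R) P P' g"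
  shows "qcoh_map U R P P' g \<in> nat_trans U R (qcoh R P) (qcoh R P')"
  unfolding nat_trans_def
proof (intro CollectI conjI ballI IntI)
  fix N assume N: "N \<in> lmods U R"
  show "qcoh_map U R P P' g N \<in> hom (Ob (qcoh R P) N) (Ob (qcoh R P') N)"
    using P g N by (auto simp: qcoh_map_def qcoh_def lmods_def
        intro!: tensor_map_hom tensor_pair.intro linear_map_id)
  show "qcoh_map U R P P' g N \<in> extensional (carrier (Ob (qcoh R P) N))"
    using N by (simp add: qcoh_map_def qcoh_def tensor_map_def)
  fix N' f x
  assume "N' \<in> lmods U R" "f \<in> mod_hom R N N'" "x \<in> carrier (Ob (qcoh R P) N)"
  then show "qcoh_map U R P P' g N' (Ar (qcoh R P) N N' f x) =
      Ar (qcoh R P') N N' f (qcoh_map U R P P' g N x)"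
    using tensor_map_interchange[OF P _ _ g mod_hom_linear, of N N' f x] N
    by (simp add: qcoh_map_def qcoh_def lmods_def)
qed (simp add: qcoh_map_def)

section \<open>Evaluation at the dual over the ring\<close>

locale module_functor = R?: ring R
  for R :: "('u, 'm) ring_scheme" (structure) and U :: "'u set set"
    and M :: "('u, 'u, 'v) mod_functor" +
  assumes universe: "universe U" and ring_in_U: "carrier R \<in> U"
    and additive: "additive_functor U R M"
begin

abbreviation "Reg \<equiv> regular_module (opp_ring R)"
abbreviation "D \<equiv> dual_at_ring U R M"
abbreviation "sml \<equiv> sml_map U R M"

lemma Reg_module: "left_module (opp_ring R) Reg"
  by (intro left_module_regular_module ring_opp_ring R.ring_axioms)

lemma Reg_lmods: "Reg \<in> lmods U (opp_ring R)"
  using Reg_module ring_in_U by (simp add: lmods_def)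

lemma carrier_D: "carrier D = nat_trans U R M (qcoh R Reg)"
  by (simp add: dual_at_ring_def Let_def dual_def nat_group_def)

lemma lmodsD: "N \<in> lmods U R \<Longrightarrow> left_module R N"
  by (simp add: lmods_def)

lemma D_value:
  assumes "w \<in> carrier D" "N \<in> lmods U R" "m \<in> carrier (Ob M N)"
  shows "w N m \<in> carrier (tensor R Reg N)"
  using hom_in_carrier[OF nat_transD(1) assms(3), of w U R "qcoh R Reg"] assms
  by (simp add: carrier_D qcoh_def)

lemma D_add:
  assumes "w \<in> carrier D" "w' \<in> carrier D"
  shows "w \<oplus>\<^bsub>D\<^esub> w' \<in> carrier D"
    and "N \<in> lmods U R \<Longrightarrow> m \<in> carrier (Ob M N) \<Longrightarrow>
      (w \<oplus>\<^bsub>D\<^esub> w') N m = w N m \<otimes>\<^bsub>tensor R Reg N\<^esub> w' N m"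
proof -
  have *: "w \<oplus>\<^bsub>D\<^esub> w' = w \<otimes>\<^bsub>nat_group U R M (qcoh R Reg)\<^esub> w'"
    by (simp add: dual_at_ring_def Let_def dual_def)
  show "w \<oplus>\<^bsub>D\<^esub> w' \<in> carrier D"
    using assms unfolding carrier_D *
    by (intro nat_trans_mult additive qcoh_comm_group[OF Reg_module] qcoh_hom[OF Reg_module])
  show "(w \<oplus>\<^bsub>D\<^esub> w') N m = w N m \<otimes>\<^bsub>tensor R Reg N\<^esub> w' N m"
    if "N \<in> lmods U R" "m \<in> carrier (Ob M N)"
    using that unfolding * by (simp add: nat_group_def qcoh_def)
qed

lemma D_smult:
  assumes "r \<in> carrier R" "w \<in> carrier D"
  shows "r \<odot>\<^bsub>D\<^esub> w \<in> carrier D"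
    and "N \<in> lmods U R \<Longrightarrow> m \<in> carrier (Ob M N) \<Longrightarrow>
      (r \<odot>\<^bsub>D\<^esub> w) N m = tensor_map R Reg N Reg N (\<lambda>x\<in>carrier R. r \<otimes>\<^bsub>R\<^esub> x) (\<lambda>l. l) (w N m)"
proof -
  have *: "r \<odot>\<^bsub>D\<^esub> w = nat_comp U R M (qcoh_map U R Reg Reg (\<lambda>x\<in>carrier R. r \<otimes>\<^bsub>R\<^esub> x)) w"
    using assms(2) by (simp add: carrier_D) (simp add: dual_at_ring_def Let_def dual_def)
  show "r \<odot>\<^bsub>D\<^esub> w \<in> carrier D"
    using nat_trans_comp[OF additive assms(2)[unfolded carrier_D]
        qcoh_map_nat_trans[OF Reg_module Reg_module linear_map_left_mult[OF R.ring_axioms assms(1)]]]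
    unfolding carrier_D * .
  show "(r \<odot>\<^bsub>D\<^esub> w) N m = tensor_map R Reg N Reg N (\<lambda>x\<in>carrier R. r \<otimes>\<^bsub>R\<^esub> x) (\<lambda>l. l) (w N m)"
    if "N \<in> lmods U R" "m \<in> carrier (Ob M N)"
    using that unfolding * by (simp add: nat_comp_def compose_def qcoh_map_def)
qed

lemma D_nonempty: "carrier D \<noteq> {}"
proof -
  have "\<one>\<^bsub>nat_group U R M (qcoh R Reg)\<^esub> \<in> carrier D"
    unfolding carrier_D
    by (intro nat_trans_one additive qcoh_comm_group[OF Reg_module] qcoh_hom[OF Reg_module])
  then show ?thesis by blast
qed

lemma sml_apply: "w \<in> carrier D \<Longrightarrow> sml N m w = lunit R N (w N m)"
  by (simp add: sml_map_def)

lemma sml_mod_hom: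
  assumes N: "N \<in> lmods U R" and m: "m \<in> carrier (Ob M N)"
  shows "sml N m \<in> mod_hom R D N"
  unfolding mod_hom_iff linear_map_def
  using lmodsD[OF N] N m
  by (auto simp: sml_apply D_add D_smult D_value lunit_closed lunit_mult lunit_smult)
    (simp add: sml_map_def)

lemma sml_closed:
  assumes "N \<in> lmods U R" "m \<in> carrier (Ob M N)" "w \<in> carrier D"
  shows "sml N m w \<in> carrier N"
  using linear_map_closed[OF mod_hom_linear[OF sml_mod_hom]] assms by blast

lemma sml_hom:
  assumes N: "N \<in> lmods U R" and w: "w \<in> carrier D"
  shows "group_hom (Ob M N) (add_monoid N) (\<lambda>m. sml N m w)"
proof -
  interpret A: comm_group "Ob M N" using additive N by (rule additive_functor_comm_group)
  interpret N: left_module R N using N by (rule lmodsD)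
  have w_hom: "w N \<in> hom (Ob M N) (tensor R Reg N)"
    using nat_transD(1)[OF w[unfolded carrier_D] N] by (simp add: qcoh_def)
  have "(\<lambda>m. sml N m w) \<in> hom (Ob M N) (add_monoid N)"
    by (rule homI) (use N w sml_closed[OF N _ w] in
      \<open>simp_all add: sml_apply hom_mult[OF w_hom] lunit_mult[OF lmodsD] D_value\<close>)
  then show ?thesis
    by (intro group_hom.intro group_hom_axioms.intro A.is_group N.a_group)
qed

lemma sml_natural:
  assumes N: "N \<in> lmods U R" "N' \<in> lmods U R" and f: "f \<in> mod_hom R N N'"
    and m: "m \<in> carrier (Ob M N)" and w: "w \<in> carrier D"
  shows "sml N' (Ar M N N' f m) w = f (sml N m w)"
  using nat_trans_natural[OF w[unfolded carrier_D] N f m] lunit_natural[OF N[THEN lmodsD] mod_hom_linear[OF f]]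
    D_value[OF w N(1) m]
  by (simp add: sml_apply[OF w] qcoh_def)

text \<open>By \<open>image_module_bidual\<close> below it is
  the \<^const>\<open>image_module\<close> of the morphism that corresponds to \<open>m\<close>; this description makes sense
  for functors that are not reflexive.\<close>

definition value_module :: "('u, 'u) module \<Rightarrow> 'v \<Rightarrow> ('u, 'u) module" where
  "value_module N m = N\<lparr>carrier := sml N m ` carrier D\<rparr>"

lemma value_submodule:
  assumes N: "N \<in> lmods U R" and m: "m \<in> carrier (Ob M N)"
  shows "submodule (sml N m ` carrier D) R N"
proof (rule left_module.submoduleI[OF lmodsD[OF N]])
  note lin = mod_hom_linear[OF sml_mod_hom[OF N m]]
  show "sml N m ` carrier D \<subseteq> carrier N" using sml_closed[OF N m] by blast
  show "sml N m ` carrier D \<noteq> {}" using D_nonempty by blast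
  fix x assume "x \<in> sml N m ` carrier D"
  then obtain v where v: "v \<in> carrier D" "x = sml N m v" by blast
  show "r \<odot>\<^bsub>N\<^esub> x \<in> sml N m ` carrier D" if "r \<in> carrier R" for r
    using linear_map_smult[OF lin that v(1)] D_smult(1)[OF that v(1)] v(2) by (metis image_eqI)
  fix y assume "y \<in> sml N m ` carrier D"
  then obtain w where w: "w \<in> carrier D" "y = sml N m w" by blast
  show "x \<oplus>\<^bsub>N\<^esub> y \<in> sml N m ` carrier D"
    using linear_map_add[OF lin v(1) w(1)] D_add(1)[OF v(1) w(1)] v(2) w(2) by (metis image_eqI)
qed

lemma submodule_lmods:
  assumes "N \<in> lmods U R" "submodule I R N"
  shows "N\<lparr>carrier := I\<rparr> \<in> lmods U R"
proof -
  interpret I: submodule I R N by fact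
  have "I \<subseteq> carrier N" using I.subset by simp
  then have "I \<in> U" using assms(1) universe unfolding universe_def lmods_def by blast
  then show ?thesis
    using left_module_submodule[OF lmodsD assms(2)] assms(1) by (simp add: lmods_def)
qed

lemma value_module_lmods:
  "N \<in> lmods U R \<Longrightarrow> m \<in> carrier (Ob M N) \<Longrightarrow> value_module N m \<in> lmods U R"
  unfolding value_module_def by (intro submodule_lmods value_submodule)

lemma value_inclusion_mod_hom:
  assumes "N \<in> lmods U R" "m \<in> carrier (Ob M N)"
  shows "(\<lambda>x\<in>carrier (value_module N m). x) \<in> mod_hom R (value_module N m) N"
proof -
  interpret submodule "sml N m ` carrier D" R N using assms by (rule value_submodule)
  show ?thesis using m_closed smult_closed subset by (auto simp: mod_hom_def value_module_def)
qed

text \<open>The element-wise form of the factorization property.\<close>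

definition lifts_to_values :: bool where
  "lifts_to_values \<longleftrightarrow> (\<forall>N\<in>lmods U R. \<forall>m\<in>carrier (Ob M N). \<exists>m'\<in>carrier (Ob M (value_module N m)).
     Ar M (value_module N m) N (\<lambda>x\<in>carrier (value_module N m). x) m' = m)"

text \<open>Apply left-exactness to \<open>0 \<rightarrow> I \<rightarrow> N \<rightarrow> N/I\<close> for the module \<open>I\<close> of values of \<open>m\<close>. The values
  of the image of \<open>m\<close> in \<open>M(N/I)\<close> are the classes of elements of \<open>I\<close>, so they vanish, and the
  Mittag-Leffler condition puts \<open>m\<close> into the kernel.\<close>

lemma lifts_to_values_if_left_exact_sml:
  assumes le: "left_exact U R M" and sml_f: "sml_functor U R M"
  shows lifts_to_values
  unfolding lifts_to_values_def
proof (intro ballI)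
  fix N m assume N: "N \<in> lmods U R" and m: "m \<in> carrier (Ob M N)"
  let ?I = "value_module N m"
  let ?i = "\<lambda>x\<in>carrier ?I. x"
  obtain Q :: "('u, 'u) module" and q where Q: "left_module R Q" "q ` carrier N = carrier Q"
    and q: "q \<in> mod_hom R N Q" "a_kernel N Q q = sml N m ` carrier D"
    by (rule quotient_module_exists[OF lmodsD[OF N] value_submodule[OF N m]])
  have "carrier Q \<in> U"
    using N universe unfolding Q(2)[symmetric] universe_def lmods_def by blast
  then have QU: "Q \<in> lmods U R" using Q(1) by (simp add: lmods_def)
  interpret A: comm_group "Ob M Q" using additive QU by (rule additive_functor_comm_group)
  have qm: "Ar M N Q q m \<in> carrier (Ob M Q)"
    using additive_functor_hom[OF additive N QU q(1)] m by (rule hom_in_carrier)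
  have "sml Q (Ar M N Q q m) w = sml Q \<one>\<^bsub>Ob M Q\<^esub> w" if w: "w \<in> carrier D" for w
  proof -
    interpret h: group_hom "Ob M Q" "add_monoid Q" "\<lambda>m. sml Q m w" using QU w by (rule sml_hom)
    have "sml N m w \<in> a_kernel N Q q" using q(2) w by blast
    then show ?thesis
      using sml_natural[OF N QU q(1) m w] h.hom_one by (simp add: a_kernel_def')
  qed
  then have "sml Q (Ar M N Q q m) = sml Q \<one>\<^bsub>Ob M Q\<^esub>"
    by (intro extensionalityI[of _ "carrier D"]) (simp_all add: sml_map_def)
  then have "Ar M N Q q m = \<one>\<^bsub>Ob M Q\<^esub>"
    using sml_f QU qm A.one_closed unfolding sml_functor_def by (meson inj_onD)
  then have "m \<in> kernel (Ob M N) (Ob M Q) (Ar M N Q q)"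
    using m by (simp add: kernel_def)
  moreover have "inj_on ?i (carrier ?I)" "?i ` carrier ?I = a_kernel N Q q"
    by (simp_all add: q(2) value_module_def inj_on_def)
  ultimately have "m \<in> Ar M ?I N ?i ` carrier (Ob M ?I)"
    using le value_module_lmods[OF N m] N QU value_inclusion_mod_hom[OF N m] q(1)
    unfolding left_exact_def by blast
  then show "\<exists>m'\<in>carrier (Ob M ?I). Ar M ?I N ?i m' = m" by (metis imageE)
qed

text \<open>If all values vanish, the inclusion of the module of values is a zero map, and an additive functor
  turns it into the trivial homomorphism.\<close>

lemma eq_one_if_lifts_to_values:
  assumes lift: lifts_to_values and N: "N \<in> lmods U R" and m: "m \<in> carrier (Ob M N)"
    and vanish: "\<And>w. w \<in> carrier D \<Longrightarrow> sml N m w = \<zero>\<^bsub>N\<^esub>"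
  shows "m = \<one>\<^bsub>Ob M N\<^esub>"
proof -
  let ?I = "value_module N m"
  obtain m' where m': "m' \<in> carrier (Ob M ?I)" "Ar M ?I N (\<lambda>x\<in>carrier ?I. x) m' = m"
    using lift N m unfolding lifts_to_values_def by blast
  have "(\<lambda>x\<in>carrier ?I. x) = (\<lambda>x\<in>carrier ?I. \<zero>\<^bsub>N\<^esub>)"
    using vanish by (auto simp: value_module_def)
  then show ?thesis
    using additive_functor_zero[OF additive value_module_lmods[OF N m] N m'(1)] m'(2) by simp
qed

lemma sml_if_lifts_to_values:
  assumes lift: lifts_to_values
  shows "sml_functor U R M"
  unfolding sml_functor_def
proof (intro ballI conjI inj_onI)
  fix N assume N: "N \<in> lmods U R"
  then show "sml N \<in> carrier (Ob M N) \<rightarrow> mod_hom R D N" using sml_mod_hom by blast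
  fix m m' assume m: "m \<in> carrier (Ob M N)" and m': "m' \<in> carrier (Ob M N)" and eq: "sml N m = sml N m'"
  interpret A: comm_group "Ob M N" using additive N by (rule additive_functor_comm_group)
  interpret N: left_module R N using N by (rule lmodsD)
  have "m \<otimes>\<^bsub>Ob M N\<^esub> inv\<^bsub>Ob M N\<^esub> m' = \<one>\<^bsub>Ob M N\<^esub>"
  proof (rule eq_one_if_lifts_to_values[OF lift N])
    fix w assume w: "w \<in> carrier D"
    interpret h: group_hom "Ob M N" "add_monoid N" "\<lambda>m. sml N m w" using N w by (rule sml_hom)
    show "sml N (m \<otimes>\<^bsub>Ob M N\<^esub> inv\<^bsub>Ob M N\<^esub> m') w = \<zero>\<^bsub>N\<^esub>"
      using h.hom_mult[OF m A.inv_closed[OF m']] h.hom_inv[OF m'] eq sml_closed[OF N m' w]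
        N.add.r_inv by simp
  qed (use m m' in simp)
  then show "m = m'" using m m' by (metis A.inv_equality A.inv_inv A.inv_closed)
qed

text \<open>For exactness at \<open>N'\<close>: if \<open>M(g)(m)\<close> is trivial, then all values of \<open>m\<close> lie in the kernel of \<open>g\<close>,
  which is the image of \<open>f\<close>. Inverting \<open>f\<close> there factors the inclusion of the module of values as
  \<open>f \<circ> j\<close>, so the lift of \<open>m\<close> pushed along \<open>j\<close> is a preimage under \<open>M(f)\<close>.\<close>

lemma left_exact_if_lifts_to_values:
  assumes lift: lifts_to_values
  shows "left_exact U R M"
  unfolding left_exact_def
proof (intro ballI impI)
  fix N N' N'' f g
  assume N: "N \<in> lmods U R" and N': "N' \<in> lmods U R" and N'': "N'' \<in> lmods U R"
    and f: "f \<in> mod_hom R N N'" and g: "g \<in> mod_hom R N' N''"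
    and "inj_on f (carrier N) \<and> f ` carrier N = a_kernel N' N'' g"
  then have inj: "inj_on f (carrier N)" and im: "f ` carrier N = a_kernel N' N'' g" by auto
  interpret N: left_module R N using N by (rule lmodsD)
  interpret N'': left_module R N'' using N'' by (rule lmodsD)
  interpret A: comm_group "Ob M N" using additive N by (rule additive_functor_comm_group)
  interpret A': comm_group "Ob M N'" using additive N' by (rule additive_functor_comm_group)
  interpret A'': comm_group "Ob M N''" using additive N'' by (rule additive_functor_comm_group)
  interpret F: group_hom "Ob M N" "Ob M N'" "Ar M N N' f"
    by (intro group_hom.intro group_hom_axioms.intro additive_functor_hom[OF additive N N' f]
        A.is_group A'.is_group)
  have f_zero: "f \<zero>\<^bsub>N\<^esub> = \<zero>\<^bsub>N'\<^esub>"
    using linear_map_zero[OF lmodsD[OF N] lmodsD[OF N'] mod_hom_linear[OF f]] .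
  show "inj_on (Ar M N N' f) (carrier (Ob M N)) \<and>
      Ar M N N' f ` carrier (Ob M N) = kernel (Ob M N') (Ob M N'') (Ar M N' N'' g)"
  proof
    have "m = \<one>\<^bsub>Ob M N\<^esub>" if m: "m \<in> carrier (Ob M N)" and 1: "Ar M N N' f m = \<one>\<^bsub>Ob M N'\<^esub>" for m
    proof (rule eq_one_if_lifts_to_values[OF lift N m])
      fix w assume w: "w \<in> carrier D"
      interpret h: group_hom "Ob M N'" "add_monoid N'" "\<lambda>m. sml N' m w" using N' w by (rule sml_hom)
      have "f (sml N m w) = f \<zero>\<^bsub>N\<^esub>"
        using sml_natural[OF N N' f m w] 1 h.hom_one f_zero by simp
      then show "sml N m w = \<zero>\<^bsub>N\<^esub>"
        using inj sml_closed[OF N m w] by (auto dest: inj_onD)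
    qed
    then show "inj_on (Ar M N N' f) (carrier (Ob M N))"
      by (intro F.inj_on_one_iff[THEN iffD2]) blast
  next
    show "Ar M N N' f ` carrier (Ob M N) = kernel (Ob M N') (Ob M N'') (Ar M N' N'' g)"
    proof (intro subset_antisym subsetI)
      fix y assume "y \<in> Ar M N N' f ` carrier (Ob M N)"
      then obtain m where m: "m \<in> carrier (Ob M N)" "y = Ar M N N' f m" by blast
      have "compose (carrier N) g f = (\<lambda>n\<in>carrier N. \<zero>\<^bsub>N''\<^esub>)"
        using im by (auto simp: compose_def a_kernel_def' intro!: restrict_ext)
      then have "Ar M N' N'' g y = \<one>\<^bsub>Ob M N''\<^esub>"
        using additive_functor_compose[OF additive N N' N'' f g m(1)]
          additive_functor_zero[OF additive N N'' m(1)] m(2) by simp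
      then show "y \<in> kernel (Ob M N') (Ob M N'') (Ar M N' N'' g)"
        using m by (simp add: kernel_def)
    next
      fix m assume "m \<in> kernel (Ob M N') (Ob M N'') (Ar M N' N'' g)"
      then have m: "m \<in> carrier (Ob M N')" and gm: "Ar M N' N'' g m = \<one>\<^bsub>Ob M N''\<^esub>"
        by (auto simp: kernel_def)
      let ?I = "value_module N' m"
      let ?i = "\<lambda>x\<in>carrier ?I. x"
      let ?j = "\<lambda>x\<in>carrier ?I. inv_into (carrier N) f x"
      obtain m' where m': "m' \<in> carrier (Ob M ?I)" "Ar M ?I N' ?i m' = m"
        using lift N' m unfolding lifts_to_values_def by blast
      (* the values of m are killed by g, so f can be inverted on them *)
      have sub: "carrier ?I \<subseteq> f ` carrier N"
      proof
        fix x assume "x \<in> carrier ?I"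
        then obtain w where w: "w \<in> carrier D" "x = sml N' m w" by (auto simp: value_module_def)
        interpret h: group_hom "Ob M N''" "add_monoid N''" "\<lambda>m. sml N'' m w"
          using N'' w(1) by (rule sml_hom)
        have "g x = \<zero>\<^bsub>N''\<^esub>"
          using sml_natural[OF N' N'' g m w(1)] gm h.hom_one w(2) by simp
        then show "x \<in> f ` carrier N"
          using im sml_closed[OF N' m w(1)] w(2) by (simp add: a_kernel_def')
      qed
      note IU = value_module_lmods[OF N' m]
      interpret I: left_module R ?I using IU by (rule lmodsD)
      have f_inv: "f (inv_into (carrier N) f x) = x" "inv_into (carrier N) f x \<in> carrier N"
        if "x \<in> carrier ?I" for x
        using that sub by (auto simp: f_inv_into_f inv_into_into)
      have inv_f: "inv_into (carrier N) f x = n" if "n \<in> carrier N" "f n = x" for x n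
        using that inj by auto
      note f_lin = mod_hom_linear[OF f]
      have j: "?j \<in> mod_hom R ?I N"
      proof -
        have "inv_into (carrier N) f (x \<oplus>\<^bsub>?I\<^esub> y) =
            inv_into (carrier N) f x \<oplus>\<^bsub>N\<^esub> inv_into (carrier N) f y"
          if "x \<in> carrier ?I" "y \<in> carrier ?I" for x y
          using that f_inv by (intro inv_f) (simp_all add: linear_map_add[OF f_lin], simp add: value_module_def)
        moreover have "inv_into (carrier N) f (r \<odot>\<^bsub>?I\<^esub> x) = r \<odot>\<^bsub>N\<^esub> inv_into (carrier N) f x"
          if "r \<in> carrier R" "x \<in> carrier ?I" for r x
          using that f_inv N.smult_closed
          by (intro inv_f) (simp_all add: linear_map_smult[OF f_lin], simp add: value_module_def)
        ultimately show ?thesis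
          using f_inv(2) I.smult_closed by (auto simp: mod_hom_def)
      qed
      have "compose (carrier ?I) f ?j = ?i"
        using f_inv(1) by (auto simp: compose_def intro!: restrict_ext)
      then have "Ar M N N' f (Ar M ?I N ?j m') = m"
        using additive_functor_compose[OF additive IU N N' j f m'(1)] m'(2) by simp
      moreover have "Ar M ?I N ?j m' \<in> carrier (Ob M N)"
        using additive_functor_hom[OF additive IU N j] m'(1) by (rule hom_in_carrier)
      ultimately show "m \<in> Ar M N N' f ` carrier (Ob M N)" by (metis image_eqI)
    qed
  qed
qed

section \<open>Morphisms from the dual of a reflexive functor\<close>

lemma carrier_dual_Reg: "carrier (Ob (dual U R M) Reg) = carrier D"
  by (simp add: dual_at_ring_def Let_def)

lemma component_at_ring_bidual:
  assumes "N \<in> lmods U R" "m \<in> carrier (Ob M N)"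
  shows "component_at_ring U R M N (bidual_map U R M N m) = sml N m"
  using assms Reg_lmods
  by (auto simp: component_at_ring_def sml_map_def bidual_map_def carrier_dual_Reg intro!: restrict_ext)

lemma image_module_bidual:
  assumes "N \<in> lmods U R" "m \<in> carrier (Ob M N)"
  shows "image_module U R M N (bidual_map U R M N m) = value_module N m"
  using assms by (simp add: image_module_def value_module_def component_at_ring_bidual)

lemma bidual_bij:
  assumes "reflexive U R M" "N \<in> lmods U R"
  shows "bij_betw (bidual_map U R M N) (carrier (Ob M N))
    (nat_trans U (opp_ring R) (dual U R M) (rqcoh R N))"
  using nat_iso_bij[OF assms[unfolded reflexive_def]] by (simp add: rdual_def nat_group_def)

lemma bidual_natural:
  assumes reflexive: "reflexive U R M" and N: "N \<in> lmods U R" "N' \<in> lmods U R"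
    and f: "f \<in> mod_hom R N N'" and m: "m \<in> carrier (Ob M N)"
  shows "bidual_map U R M N' (Ar M N N' f m) =
    nat_comp U (opp_ring R) (dual U R M) (rqcoh_map U R N N' f) (bidual_map U R M N m)"
proof -
  have "bidual_map U R M \<in> nat_trans U R M (rdual U R (dual U R M))"
    using reflexive by (simp add: reflexive_def nat_iso_def)
  from nat_trans_natural[OF this N f m] show ?thesis
    using bij_betw_apply[OF bidual_bij[OF reflexive N(1)] m] by (simp add: rdual_def)
qed

text \<open>The bidual map is bijective at \<open>N\<close> and at the module of values, so \<open>f\<close> and \<open>h\<close> may be replaced by
  elements \<open>m\<close> and \<open>m'\<close>; by naturality the factorization of \<open>f\<close> through \<open>h\<close> then states that the
  inclusion carries \<open>m'\<close> to \<open>m\<close>.\<close>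

lemma lifts_to_values_iff_factorization:
  assumes reflexive: "reflexive U R M"
  shows "lifts_to_values \<longleftrightarrow>
    (\<forall>N\<in>lmods U R. \<forall>f\<in>nat_trans U (opp_ring R) (dual U R M) (rqcoh R N).
       \<exists>h\<in>nat_trans U (opp_ring R) (dual U R M) (rqcoh R (image_module U R M N f)).
         f = nat_comp U (opp_ring R) (dual U R M)
               (rqcoh_map U R (image_module U R M N f) N
                 (\<lambda>x\<in>carrier (image_module U R M N f). x)) h)"
proof -
  have key: "(\<exists>m'\<in>carrier (Ob M (value_module N m)).
          Ar M (value_module N m) N (\<lambda>x\<in>carrier (value_module N m). x) m' = m) \<longleftrightarrow>
      (\<exists>h\<in>nat_trans U (opp_ring R) (dual U R M) (rqcoh R (value_module N m)).
         bidual_map U R M N m = nat_comp U (opp_ring R) (dual U R M)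
               (rqcoh_map U R (value_module N m) N (\<lambda>x\<in>carrier (value_module N m). x)) h)"
    if N: "N \<in> lmods U R" and m: "m \<in> carrier (Ob M N)" for N m
  proof -
    let ?I = "value_module N m"
    let ?i = "\<lambda>x\<in>carrier ?I. x"
    note I = value_module_lmods[OF N m] and i = value_inclusion_mod_hom[OF N m]
    have "Ar M ?I N ?i m' = m \<longleftrightarrow>
        bidual_map U R M N m = nat_comp U (opp_ring R) (dual U R M) (rqcoh_map U R ?I N ?i)
          (bidual_map U R M ?I m')" if m': "m' \<in> carrier (Ob M ?I)" for m'
    proof -
      have "Ar M ?I N ?i m' \<in> carrier (Ob M N)"
        using additive_functor_hom[OF additive I N i] m' by (rule hom_in_carrier)
      then show ?thesis
        using bidual_bij[OF reflexive N] m bidual_natural[OF reflexive I N i m']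
        by (metis bij_betw_imp_inj_on inj_onD)
    qed
    then show ?thesis
      unfolding bij_betw_imp_surj_on[OF bidual_bij[OF reflexive I], symmetric] by auto
  qed
  show ?thesis
    unfolding lifts_to_values_def
    by (intro ball_cong refl)
      (simp add: bij_betw_imp_surj_on[OF bidual_bij[OF assms], symmetric] image_module_bidual key)
qed

end

theorem theorem5p8:
  fixes R :: "('u, 'm) ring_scheme"
    and U :: "'u set set"
    and M :: "('u, 'u, 'v) mod_functor"
  assumes "ring R"
    and "universe U" and "carrier R \<in> U"
    and "additive_functor U R M"
    and "reflexive U R M"
  shows "left_exact U R M \<and> sml_functor U R M \<longleftrightarrow>
    (\<forall>N\<in>lmods U R. \<forall>f\<in>nat_trans U (opp_ring R) (dual U R M) (rqcoh R N).
       \<exists>h\<in>nat_trans U (opp_ring R) (dual U R M) (rqcoh R (image_module U R M N f)).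
         f = nat_comp U (opp_ring R) (dual U R M)
               (rqcoh_map U R (image_module U R M N f) N
                 (\<lambda>x\<in>carrier (image_module U R M N f). x)) h)"
proof -
  interpret module_functor R U M
    using assms by (intro module_functor.intro module_functor_axioms.intro)
  have "left_exact U R M \<and> sml_functor U R M \<longleftrightarrow> lifts_to_values"
    using lifts_to_values_if_left_exact_sml left_exact_if_lifts_to_values sml_if_lifts_to_values
    by blast
  then show ?thesis
    using lifts_to_values_iff_factorization[OF assms(5)] by (rule trans)
qed

end
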